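(* Let $\mathcal{F} = \{f_i\}_{i \in I}$ be a frame sequence in $H$ and let $a \colon I \to G$ be a map. If (a) $(\mathcal{F},a)$ is $\ell^1$-localized with respect to its canonical dual frame sequence, (b) $D^+(I,a) < \infty$, and (c) $\inf_{i\in I} \|f_i\| > 0$, then $\mathcal{F}$ can be written as a finite union of Riesz sequences; that is, $I$ can be partitioned into finitely many subsets $I_1,\dots,I_n$ such that each $\{f_i\}_{i\in I_k}$ is a Riesz sequence.
   Context: $H$ is a separable Hilbert space and $I$ is a countable index set. $G = \prod_{i=1}^d a_i \mathbf{Z} \times \prod_{j=1}^e \mathbf{Z}_{n_j}$ (with $d \ge 1$, $a_i>0$, a countably infinite abelian group), equipped with $|g| = \sup\{|a_1 k_1|,\dots,|a_d k_d|,\delta(m_1),\dots,\delta(m_e)\}$ for $g=(a_1k_1,\dots,a_dk_d,m_1,\dots,m_e)$, where $\delta(0)=0$ and $\delta(m)=1$ for $m\neq 0$. For $N \in \mathbf{N}$ and $j\in G$ put $S_N(j) = \{k \in G : |k-j| \le N/2\}$ and $I_N(j) = a^{-1}(S_N(j))$. The upper density is $D^+(I,a) = \limsup_{N\to\infty} \sup_{j\in G} |I_N(j)|/|S_N(j)|$. A frame sequence is a frame for its closed linear span; $\{\tilde f_i\}_{i\in I}$ denotes its canonical dual frame within that span ($\tilde f_i=S^{-1}f_i$, $Sf=\sum_i\langle f,f_i\rangle f_i$ on the span). $(\mathcal{F},a)$ is $\ell^1$-localized with respect to its canonical dual frame sequence if there exists $r\in\ell^1(G)$ with $|\langle f_i,\tilde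 f_j\rangle|\le r_{a(i)-a(j)}$ for all $i,j\in I$. A Riesz sequence is a Riesz basis for its closed linear span. *)

theory Defs
  imports
    "HOL-Analysis.Analysis"
    "HOL-Library.Disjoint_Sets"
    "HOL-Algebra.Product_Groups"
    "HOL-Algebra.Elementary_Groups"
begin

(* The scalars of a Hilbert space. By the Gelfand-Mazur theorem a type in real_normed_field is
   isomorphic to the reals or to the complex numbers, and the axiom mult_conjg forces conjg to
   be the usual conjugation. *)
class rc_field = real_normed_field +
  fixes conjg :: "'a \<Rightarrow> 'a"
  assumes conjg_add: "conjg (x + y) = conjg x + conjg y"
    and conjg_mult: "conjg (x * y) = conjg x * conjg y"
    and conjg_conjg: "conjg (conjg x) = x"
    and mult_conjg: "x * conjg x = (norm x)\<^sup>2 *\<^sub>R 1"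

instantiation real :: rc_field
begin

definition conjg_real :: "real \<Rightarrow> real" where
  "conjg_real x = x"

instance
  by standard (simp_all add: conjg_real_def power2_eq_square)

end

instantiation complex :: rc_field
begin

definition conjg_complex :: "complex \<Rightarrow> complex" where
  "conjg_complex = cnj"

instance
  by standard (simp_all add: conjg_complex_def scaleR_conv_of_real complex_norm_square del: of_real_power)

end

(* The inner product is linear in its first argument; its norm is that of the complete normed
   space 'v. The scalars 'k are either the reals or the complex numbers. *)
locale hilbert_space = vector_space smul
  for smul :: "'k::rc_field \<Rightarrow> 'v::banach \<Rightarrow> 'v" +
  fixes ip :: "'v \<Rightarrow> 'v \<Rightarrow> 'k"
  assumes scale_of_real: "smul (of_real r) x = r *\<^sub>R x"
    and ip_add_left: "ip (x + y) z = ip x z + ip y z"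
    and ip_scale_left: "ip (smul c x) y = c * ip x y"
    and ip_commute: "ip y x = conjg (ip x y)"
    and ip_self: "ip x x = of_real ((norm x)\<^sup>2)"

lemma hilbert_space_real:
  "hilbert_space scaleR (inner :: 'v::{real_inner,banach} \<Rightarrow> 'v \<Rightarrow> real)"
  by unfold_locales
    (auto simp: conjg_real_def inner_add_left inner_add_right inner_commute power2_norm_eq_inner
      scaleR_add_right scaleR_add_left)

lemma hilbert_space_complex:
  "hilbert_space (*) (\<lambda>x y :: complex. x * cnj y)"
  by unfold_locales
    (auto simp: conjg_complex_def algebra_simps scaleR_conv_of_real complex_norm_square
      simp flip: of_real_power)


definition closed_span :: "('k::rc_field \<Rightarrow> 'v::banach \<Rightarrow> 'v) \<Rightarrow> 'v set \<Rightarrow> 'v set" where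
  "closed_span smul X = closure (module.span smul X)"

definition frame_for ::
  "('v::banach \<Rightarrow> 'v \<Rightarrow> 'k::rc_field) \<Rightarrow> 'v set \<Rightarrow> ('i \<Rightarrow> 'v) \<Rightarrow> 'i set \<Rightarrow> bool" where
  "frame_for ip V f I \<longleftrightarrow> f ` I \<subseteq> V \<and>
     (\<exists>A B. 0 < A \<and> 0 < B \<and>
       (\<forall>x\<in>V. (\<lambda>i. (norm (ip x (f i)))\<^sup>2) summable_on I \<and>
              A * (norm x)\<^sup>2 \<le> (\<Sum>\<^sub>\<infinity>i\<in>I. (norm (ip x (f i)))\<^sup>2) \<and>
              (\<Sum>\<^sub>\<infinity>i\<in>I. (norm (ip x (f i)))\<^sup>2) \<le> B * (norm x)\<^sup>2))"

definition frame_sequence ::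
  "('k::rc_field \<Rightarrow> 'v::banach \<Rightarrow> 'v) \<Rightarrow> ('v \<Rightarrow> 'v \<Rightarrow> 'k) \<Rightarrow> ('i \<Rightarrow> 'v) \<Rightarrow> 'i set \<Rightarrow> bool" where
  "frame_sequence smul ip f I \<longleftrightarrow> frame_for ip (closed_span smul (f ` I)) f I"

definition frame_operator ::
  "('k::rc_field \<Rightarrow> 'v::banach \<Rightarrow> 'v) \<Rightarrow> ('v \<Rightarrow> 'v \<Rightarrow> 'k) \<Rightarrow> ('i \<Rightarrow> 'v) \<Rightarrow> 'i set \<Rightarrow> 'v \<Rightarrow> 'v" where
  "frame_operator smul ip f I x = (\<Sum>\<^sub>\<infinity>i\<in>I. smul (ip x (f i)) (f i))"

(* For a frame sequence the frame operator is a bijection of the closed span onto itself. *)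
definition canonical_dual ::
  "('k::rc_field \<Rightarrow> 'v::banach \<Rightarrow> 'v) \<Rightarrow> ('v \<Rightarrow> 'v \<Rightarrow> 'k) \<Rightarrow> ('i \<Rightarrow> 'v) \<Rightarrow> 'i set \<Rightarrow> 'i \<Rightarrow> 'v" where
  "canonical_dual smul ip f I i =
     inv_into (closed_span smul (f ` I)) (frame_operator smul ip f I) (f i)"

definition orthonormal_basis_of ::
  "('k::rc_field \<Rightarrow> 'v::banach \<Rightarrow> 'v) \<Rightarrow> ('v \<Rightarrow> 'v \<Rightarrow> 'k) \<Rightarrow> 'v set \<Rightarrow> ('i \<Rightarrow> 'v) \<Rightarrow> 'i set \<Rightarrow> bool" where
  "orthonormal_basis_of smul ip V e J \<longleftrightarrow>
     (\<forall>i\<in>J. \<forall>j\<in>J. ip (e i) (e j) = (if i = j then 1 else 0)) \<and> closed_span smul (e ` J) = V"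

definition bounded_bijective_on ::
  "('k::rc_field \<Rightarrow> 'v::banach \<Rightarrow> 'v) \<Rightarrow> 'v set \<Rightarrow> ('v \<Rightarrow> 'v) \<Rightarrow> bool" where
  "bounded_bijective_on smul V T \<longleftrightarrow>
     (\<forall>x\<in>V. \<forall>y\<in>V. T (x + y) = T x + T y) \<and>
     (\<forall>c. \<forall>x\<in>V. T (smul c x) = smul c (T x)) \<and>
     (\<exists>C. \<forall>x\<in>V. norm (T x) \<le> C * norm x) \<and>
     bij_betw T V V"

definition riesz_basis_of ::
  "('k::rc_field \<Rightarrow> 'v::banach \<Rightarrow> 'v) \<Rightarrow> ('v \<Rightarrow> 'v \<Rightarrow> 'k) \<Rightarrow> 'v set \<Rightarrow> ('i \<Rightarrow> 'v) \<Rightarrow> 'i set \<Rightarrow> bool" where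
  "riesz_basis_of smul ip V f J \<longleftrightarrow>
     (\<exists>e T. orthonormal_basis_of smul ip V e J \<and> bounded_bijective_on smul V T \<and>
            (\<forall>i\<in>J. f i = T (e i)))"

definition riesz_sequence ::
  "('k::rc_field \<Rightarrow> 'v::banach \<Rightarrow> 'v) \<Rightarrow> ('v \<Rightarrow> 'v \<Rightarrow> 'k) \<Rightarrow> ('i \<Rightarrow> 'v) \<Rightarrow> 'i set \<Rightarrow> bool" where
  "riesz_sequence smul ip f J \<longleftrightarrow> riesz_basis_of smul ip (closed_span smul (f ` J)) f J"


type_synonym index = "(nat \<Rightarrow> real) \<times> (nat \<Rightarrow> int)"

definition scaled_integer_group :: "real \<Rightarrow> real monoid" where
  "scaled_integer_group \<alpha> =
     \<lparr>carrier = range (\<lambda>k::int. \<alpha> * of_int k), monoid.mult = (+), one = 0\<rparr>"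

(* The product of the groups \<alpha> i Z for i < d and Z / n j for j < e. The group is written
   multiplicatively, so the difference g - h appears below as the product of g and inv h. *)
definition index_group :: "nat \<Rightarrow> nat \<Rightarrow> (nat \<Rightarrow> real) \<Rightarrow> (nat \<Rightarrow> nat) \<Rightarrow> index monoid" where
  "index_group d e \<alpha> n =
     product_group {..<d} (\<lambda>i. scaled_integer_group (\<alpha> i)) \<times>\<times>
     product_group {..<e} (\<lambda>j. integer_mod_group (n j))"

definition group_abs :: "nat \<Rightarrow> nat \<Rightarrow> index \<Rightarrow> real" where
  "group_abs d e g =
     Sup ((\<lambda>i. \<bar>fst g i\<bar>) ` {..<d} \<union> (\<lambda>j. if snd g j = 0 then 0 else 1) ` {..<e})"

definition group_box :: "'g monoid \<Rightarrow> ('g \<Rightarrow> real) \<Rightarrow> nat \<Rightarrow> 'g \<Rightarrow> 'g set" where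
  "group_box G len N j = {k \<in> carrier G. len (k \<otimes>\<^bsub>G\<^esub> inv\<^bsub>G\<^esub> j) \<le> real N / 2}"

(* Cardinalities are taken in the counting measure, so that an infinite preimage of a box
   counts as infinite, whereas card would give 0. *)
definition upper_density ::
  "'g monoid \<Rightarrow> ('g \<Rightarrow> real) \<Rightarrow> 'i set \<Rightarrow> ('i \<Rightarrow> 'g) \<Rightarrow> ennreal" where
  "upper_density G len I a =
     limsup (\<lambda>N. SUP j\<in>carrier G.
       emeasure (count_space UNIV) {i \<in> I. a i \<in> group_box G len N j} /
       emeasure (count_space UNIV) (group_box G len N j))"

definition l1_localized_wrt_dual ::
  "('k::rc_field \<Rightarrow> 'v::banach \<Rightarrow> 'v) \<Rightarrow> ('v \<Rightarrow> 'v \<Rightarrow> 'k) \<Rightarrow> 'g monoid \<Rightarrow>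
   ('i \<Rightarrow> 'v) \<Rightarrow> 'i set \<Rightarrow> ('i \<Rightarrow> 'g) \<Rightarrow> bool" where
  "l1_localized_wrt_dual smul ip G f I a \<longleftrightarrow>
     (\<exists>r :: 'g \<Rightarrow> real. (\<lambda>g. \<bar>r g\<bar>) summable_on carrier G \<and>
       (\<forall>i\<in>I. \<forall>j\<in>I.
          norm (ip (f i) (canonical_dual smul ip f I j)) \<le> r (a i \<otimes>\<^bsub>G\<^esub> inv\<^bsub>G\<^esub> a j)))"

end

theory Submission
  imports Defs
begin

text \<open>Let \<open>S\<close> be the frame operator on the closed span \<open>V\<close> of the family, with frame bounds \<open>A\<close> and
  \<open>B\<close>, and write \<open>f~ j = S\<^sup>-\<^sup>1 (f j)\<close>. For a finite combination \<open>x\<close> of the \<open>f i\<close> with coefficients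
  \<open>c\<close>, the number \<open>ip x (S\<^sup>-\<^sup>1 x)\<close> is the value at \<open>c\<close> of the form with matrix \<open>ip (f i) (f~ j)\<close>, and it
  is at most \<open>(norm x)\<^sup>2 / A\<close>. So \<open>\<ell>\<^sup>1\<close> localization, which concerns this mixed matrix and not the
  Gram matrix of \<open>f\<close>, can still be used to bound \<open>norm x\<close> from below: the mixed matrix is the Gram
  matrix of the Parseval frame \<open>S\<^sup>-\<^sup>1\<^sup>/\<^sup>2 f\<close>, but no square root of \<open>S\<close> is taken
  (\<open>lower_riesz_bound_if_diagonally_dominant\<close>).

  The diagonal entries of the matrix are at least \<open>C\<^sup>2 / B\<close> when \<open>norm (f i) \<ge> C\<close> for all \<open>i\<close>. Its
  off-diagonal part is made small by splitting \<open>I\<close>. Finite density bounds the fibres of \<open>a\<close>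
  (\<open>bounded_fibres_if_finite_density\<close>). Let \<open>F\<close> be a finite set of group elements containing the
  unit, outside which \<open>r\<close> has small \<open>\<ell>\<^sup>1\<close> norm, and call two indices in conflict when the difference
  of their images, in one order or the other, lies in \<open>F\<close>. This graph has bounded degree, so finitely
  many colours suffice, and on a colour class all off-diagonal row and column sums of the matrix are
  parts of the tail of \<open>r\<close> (\<open>partition_with_small_off_diagonal\<close>). Schur's test then gives diagonal
  dominance, hence a lower Riesz bound on each class; the upper one is the Bessel bound of the frame.

  A countable family with both Riesz bounds is linearly independent, so Gram-Schmidt yields an
  orthonormal basis of its closed span with the same index set, and the operator carrying this basis
  to the family is a bounded bijection (\<open>riesz_sequence_if_riesz_bounds\<close>).\<close>

section \<open>Inner products over the real or complex scalars\<close>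

lemma conjg_0 [simp]: "conjg (0 :: 'k::rc_field) = 0"
  using conjg_add[of "0::'k" 0] by simp

lemma mult_conjg_of_real: "x * conjg x = of_real ((norm (x :: 'k::rc_field))\<^sup>2)"
  by (simp add: mult_conjg scaleR_conv_of_real)

lemma conjg_of_real [simp]: "conjg (of_real r :: 'k::rc_field) = of_real r"
proof (cases "r = 0")
  case False
  have "of_real r * conjg (of_real r :: 'k) = of_real r * of_real r"
    by (simp add: mult_conjg_of_real power2_eq_square del: of_real_power flip: of_real_mult)
  then show ?thesis using False by simp
qed simp

lemma norm_conjg [simp]: "norm (conjg x :: 'k::rc_field) = norm x"
proof (cases "x = 0")
  case False
  have "norm x * norm (conjg x) = norm x * norm x"
    by (simp add: mult_conjg power2_eq_square flip: norm_mult)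
  then show ?thesis using False by simp
qed simp

context hilbert_space
begin

lemma ip_add_right: "ip x (y + z) = ip x y + ip x z"
  by (metis ip_add_left ip_commute conjg_add)

lemma ip_scale_right: "ip x (smul c y) = conjg c * ip x y"
  by (metis ip_scale_left ip_commute conjg_mult)

lemma ip_zero_left [simp]: "ip 0 x = 0"
  using ip_scale_left[of 0 0 x] by simp

lemma ip_zero_right [simp]: "ip x 0 = 0"
  using ip_scale_right[of x 0 0] by simp

lemma ip_minus_left: "ip (- x) y = - ip x y"
  using ip_add_left[of x "- x" y] by (simp add: add_eq_0_iff)

lemma ip_minus_right: "ip x (- y) = - ip x y"
  using ip_add_right[of x y "- y"] by (simp add: add_eq_0_iff)

lemma ip_diff_left: "ip (x - y) z = ip x z - ip y z"
  using ip_add_left[of x "- y" z] by (simp add: ip_minus_left)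

lemma ip_diff_right: "ip x (y - z) = ip x y - ip x z"
  using ip_add_right[of x y "- z"] by (simp add: ip_minus_right)

lemma ip_sum_left: "ip (sum g A) y = (\<Sum>i\<in>A. ip (g i) y)"
  by (induction A rule: infinite_finite_induct) (simp_all add: ip_add_left)

lemma ip_sum_right: "ip x (sum g A) = (\<Sum>i\<in>A. ip x (g i))"
  by (induction A rule: infinite_finite_induct) (simp_all add: ip_add_right)

lemma ip_combination_left: "ip (\<Sum>i\<in>A. smul (c i) (g i)) y = (\<Sum>i\<in>A. c i * ip (g i) y)"
  by (simp add: ip_sum_left ip_scale_left)

lemma ip_combination_right:
  "ip x (\<Sum>i\<in>A. smul (c i) (g i)) = (\<Sum>i\<in>A. conjg (c i) * ip x (g i))"
  by (simp add: ip_sum_right ip_scale_right)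

lemma norm_ip_commute: "norm (ip x y) = norm (ip y x)"
  by (metis ip_commute norm_conjg)

lemma norm_smul: "norm (smul c x) = norm c * norm x"
proof -
  have "of_real ((norm (smul c x))\<^sup>2) = c * conjg c * ip x x"
    unfolding ip_self[symmetric] by (simp add: ip_scale_left ip_scale_right)
  also have "\<dots> = of_real ((norm c * norm x)\<^sup>2)"
    by (simp add: mult_conjg_of_real ip_self power_mult_distrib)
  finally have "(norm (smul c x))\<^sup>2 = (norm c * norm x)\<^sup>2"
    by (simp only: of_real_eq_iff)
  then show ?thesis by (simp add: power2_eq_iff_nonneg)
qed

lemma Cauchy_Schwarz: "norm (ip x y) \<le> norm x * norm y"
proof (cases "y = 0")
  case False
  define c where "c = ip x y / ip y y"
  have yy: "ip y y \<noteq> 0" using False by (simp add: ip_self)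
  \<comment> \<open>\<open>x - c y\<close> is the component of \<open>x\<close> orthogonal to \<open>y\<close>.\<close>
  have "ip (x - smul c y) y = 0"
    using yy by (simp add: ip_diff_left ip_scale_left c_def)
  then have "ip (x - smul c y) (x - smul c y) = ip (x - smul c y) x"
    by (simp add: ip_diff_right ip_scale_right)
  also have "\<dots> = ip x x - c * ip y x"
    by (simp add: ip_diff_left ip_scale_left)
  also have "c * ip y x = of_real ((norm (ip x y))\<^sup>2 / (norm y)\<^sup>2)"
    by (simp add: c_def ip_commute[of y x] mult_conjg_of_real ip_self)
  finally have "(norm (x - smul c y))\<^sup>2 = (norm x)\<^sup>2 - (norm (ip x y))\<^sup>2 / (norm y)\<^sup>2"
    by (simp only: ip_self of_real_eq_iff flip: of_real_diff)
  then have "(norm (ip x y))\<^sup>2 / (norm y)\<^sup>2 \<le> (norm x)\<^sup>2"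
    by (metis diff_ge_0_iff_ge zero_le_power2)
  then have "(norm (ip x y))\<^sup>2 \<le> (norm x * norm y)\<^sup>2"
    using False by (simp add: power_mult_distrib field_simps)
  then show ?thesis by (rule power2_le_imp_le) simp
qed simp

lemma bounded_linear_ip_left: "bounded_linear (\<lambda>x. ip x y)"
proof (rule bounded_linear_intro)
  show "ip (r *\<^sub>R x) y = r *\<^sub>R ip x y" for r x
    by (simp add: scale_of_real[symmetric] ip_scale_left scaleR_conv_of_real)
  show "norm (ip x y) \<le> norm x * norm y" for x
    by (rule Cauchy_Schwarz)
qed (simp add: ip_add_left)

lemma bounded_linear_smul_right: "bounded_linear (smul c)"
proof (rule bounded_linear_intro)
  show "smul c (r *\<^sub>R x) = r *\<^sub>R smul c x" for r x
    by (simp add: scale_of_real[symmetric] mult.commute)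
  show "norm (smul c x) \<le> norm x * norm c" for x
    by (simp add: norm_smul mult.commute)
qed (simp add: scale_right_distrib)

lemma closed_closed_span: "closed (closed_span smul X)"
  by (simp add: closed_span_def)

lemma span_subset_closed_span: "span X \<subseteq> closed_span smul X"
  by (simp add: closed_span_def closure_subset)

lemma closed_span_superset: "X \<subseteq> closed_span smul X"
  using span_superset span_subset_closed_span by blast

lemma subspace_closed_span: "subspace (closed_span smul X)"
proof (rule subspaceI)
  show "0 \<in> closed_span smul X"
    using span_subset_closed_span span_zero by blast
  show "x + y \<in> closed_span smul X" if "x \<in> closed_span smul X" "y \<in> closed_span smul X" for x y
  proof -
    from that obtain u v where "\<And>n. u n \<in> span X" "u \<longlonglongrightarrow> x" "\<And>n. v n \<in> span X" "v \<longlonglongrightarrow> y"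
      unfolding closed_span_def closure_sequential by blast
    then have "\<And>n. u n + v n \<in> span X" "(\<lambda>n. u n + v n) \<longlonglongrightarrow> x + y"
      by (auto intro: span_add tendsto_add)
    then show ?thesis unfolding closed_span_def closure_sequential
      by (intro exI[of _ "\<lambda>n. u n + v n"]) simp
  qed
  show "smul c x \<in> closed_span smul X" if "x \<in> closed_span smul X" for c x
  proof -
    from that obtain u where "\<And>n. u n \<in> span X" "u \<longlonglongrightarrow> x"
      unfolding closed_span_def closure_sequential by blast
    then have "\<And>n. smul c (u n) \<in> span X" "(\<lambda>n. smul c (u n)) \<longlonglongrightarrow> smul c x"
      by (auto intro: span_scale bounded_linear.tendsto[OF bounded_linear_smul_right])
    then show ?thesis unfolding closed_span_def closure_sequential
      by (intro exI[of _ "\<lambda>n. smul c (u n)"]) simp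
  qed
qed

lemma closed_span_least:
  assumes "X \<subseteq> W" "subspace W" "closed W"
  shows "closed_span smul X \<subseteq> W"
  unfolding closed_span_def using assms by (intro closure_minimal span_minimal)

lemma closed_span_eqI:
  assumes "span X = span Y"
  shows "closed_span smul X = closed_span smul Y"
  using assms by (simp add: closed_span_def)

text \<open>The vectors orthogonal to \<open>x\<close> form a closed subspace.\<close>

lemma orthogonal_closed_span:
  assumes "\<And>y. y \<in> X \<Longrightarrow> ip y x = 0" and "z \<in> closed_span smul X"
  shows "ip z x = 0"
proof -
  have "closed_span smul X \<subseteq> {z. ip z x = 0}"
  proof (rule closed_span_least)
    show "subspace {z. ip z x = 0}"
      by (rule subspaceI) (simp_all add: ip_add_left ip_scale_left)
    show "closed {z. ip z x = 0}"
      by (intro closed_Collect_eq continuous_intros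
          bounded_linear.continuous_on[OF bounded_linear_ip_left])
  qed (use assms in auto)
  then show ?thesis using assms by blast
qed

lemma infsum_in_closed_span:
  assumes "\<And>i. i \<in> J \<Longrightarrow> g i \<in> closed_span smul X"
  shows "infsum g J \<in> closed_span smul X"
proof (cases "g summable_on J")
  case True
  then have lim: "(sum g \<longlongrightarrow> infsum g J) (finite_subsets_at_top J)"
    using has_sum_infsum has_sum_def by blast
  have "\<forall>\<^sub>F K in finite_subsets_at_top J. sum g K \<in> closed_span smul X"
    using assms by (auto intro!: eventually_finite_subsets_at_top_weakI
        subspace_sum[OF subspace_closed_span])
  then show ?thesis
    using Lim_in_closed_set[OF closed_closed_span _ finite_subsets_at_top_neq_bot lim] by blast
next
  case False
  then show ?thesis
    using subspace_0[OF subspace_closed_span] by (simp add: infsum_not_exists)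
qed

end

section \<open>Bessel bounds and infinite linear combinations\<close>

text \<open>The Cauchy criterion for unordered sums.\<close>

lemma summable_on_if_small_tails:
  fixes g :: "'i \<Rightarrow> 'b::banach"
  assumes tails: "\<And>\<epsilon>. \<epsilon> > 0 \<Longrightarrow>
      \<exists>F. finite F \<and> F \<subseteq> A \<and> (\<forall>K. finite K \<and> K \<subseteq> A \<and> K \<inter> F = {} \<longrightarrow> norm (sum g K) < \<epsilon>)"
  shows "g summable_on A"
proof -
  have "\<exists>P. eventually P (finite_subsets_at_top A) \<and>
              (\<forall>K L. P K \<and> P L \<longrightarrow> dist (sum g K) (sum g L) < \<epsilon>)" if "\<epsilon> > 0" for \<epsilon>
  proof -
    have "\<epsilon> / 2 > 0" using that by simp
    from tails[OF this] obtain F where F: "finite F" "F \<subseteq> A"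
      and "\<forall>K. finite K \<and> K \<subseteq> A \<and> K \<inter> F = {} \<longrightarrow> norm (sum g K) < \<epsilon> / 2"
      by (elim exE conjE)
    then have small: "norm (sum g K) < \<epsilon> / 2" if "finite K" "K \<subseteq> A" "K \<inter> F = {}" for K
      using that by simp
    define P where "P K \<longleftrightarrow> finite K \<and> F \<subseteq> K \<and> K \<subseteq> A" for K
    have "eventually P (finite_subsets_at_top A)"
      unfolding eventually_finite_subsets_at_top using F by (auto simp: P_def)
    moreover have "dist (sum g K) (sum g L) < \<epsilon>" if "P K" "P L" for K L
    proof -
      have fin: "finite K" "finite L" using that by (auto simp: P_def)
      have "sum g K - sum g L = sum g (K - L) - sum g (L - K)"
        using sum.Int_Diff[OF fin(1), of g L] sum.Int_Diff[OF fin(2), of g K]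
        by (simp add: Int_commute)
      also have "norm \<dots> \<le> norm (sum g (K - L)) + norm (sum g (L - K))"
        by (rule norm_triangle_ineq4)
      also have "\<dots> < \<epsilon> / 2 + \<epsilon> / 2"
        by (intro add_strict_mono small) (use that in \<open>auto simp: P_def\<close>)
      finally show ?thesis by (simp add: dist_norm)
    qed
    ultimately show ?thesis by blast
  qed
  then have "cauchy_filter (filtermap (sum g) (finite_subsets_at_top A))"
    by (simp add: cauchy_filter_metric_filtermap)
  moreover have "complete (UNIV :: 'b set)"
    by (meson Cauchy_convergent UNIV_I complete_def convergent_def)
  ultimately obtain l where "(sum g \<longlongrightarrow> l) (finite_subsets_at_top A)"
    using complete_uniform[where S=UNIV] by (force simp add: filterlim_def)
  then show ?thesis
    using summable_on_def has_sum_def by blast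
qed

context hilbert_space
begin

text \<open>The two Riesz bounds are stated for finite combinations only, so that they make sense before any
  convergence is known; an upper Riesz bound is the same thing as a Bessel bound.\<close>

definition bessel_bound :: "real \<Rightarrow> ('i \<Rightarrow> 'v) \<Rightarrow> 'i set \<Rightarrow> bool" where
  "bessel_bound B f J \<longleftrightarrow> (\<forall>K c. finite K \<longrightarrow> K \<subseteq> J \<longrightarrow>
     (norm (\<Sum>i\<in>K. smul (c i) (f i)))\<^sup>2 \<le> B * (\<Sum>i\<in>K. (norm (c i))\<^sup>2))"

definition lower_riesz_bound :: "real \<Rightarrow> ('i \<Rightarrow> 'v) \<Rightarrow> 'i set \<Rightarrow> bool" where
  "lower_riesz_bound A f J \<longleftrightarrow> (\<forall>K c. finite K \<longrightarrow> K \<subseteq> J \<longrightarrow>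
     A * (\<Sum>i\<in>K. (norm (c i))\<^sup>2) \<le> (norm (\<Sum>i\<in>K. smul (c i) (f i)))\<^sup>2)"

lemma bessel_boundD:
  "bessel_bound B f J \<Longrightarrow> finite K \<Longrightarrow> K \<subseteq> J \<Longrightarrow>
    (norm (\<Sum>i\<in>K. smul (c i) (f i)))\<^sup>2 \<le> B * (\<Sum>i\<in>K. (norm (c i))\<^sup>2)"
  unfolding bessel_bound_def by blast

lemma lower_riesz_boundD:
  "lower_riesz_bound A f J \<Longrightarrow> finite K \<Longrightarrow> K \<subseteq> J \<Longrightarrow>
    A * (\<Sum>i\<in>K. (norm (c i))\<^sup>2) \<le> (norm (\<Sum>i\<in>K. smul (c i) (f i)))\<^sup>2"
  unfolding lower_riesz_bound_def by blast

lemma bessel_bound_subset: "bessel_bound B f I \<Longrightarrow> J \<subseteq> I \<Longrightarrow> bessel_bound B f J"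
  unfolding bessel_bound_def by blast

text \<open>A square-summable coefficient family has small tails, and the Bessel bound turns them into small
  tails of the vector sum.\<close>

lemma synthesis_summable:
  assumes bessel: "bessel_bound B f J" and "0 < B"
    and c: "(\<lambda>i. (norm (c i))\<^sup>2) summable_on J"
  shows "(\<lambda>i. smul (c i) (f i)) summable_on J"
proof (rule summable_on_if_small_tails)
  fix \<epsilon> :: real assume "\<epsilon> > 0"
  define \<delta> where "\<delta> = \<epsilon>\<^sup>2 / (2 * B)"
  have "\<delta> > 0" using \<open>\<epsilon> > 0\<close> \<open>0 < B\<close> by (simp add: \<delta>_def)
  then obtain F where F: "finite F" "F \<subseteq> J"
    and near: "dist (\<Sum>i\<in>F. (norm (c i))\<^sup>2) (\<Sum>\<^sub>\<infinity>i\<in>J. (norm (c i))\<^sup>2) \<le> \<delta>"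
    using infsum_finite_approximation[OF c] by blast
  have "norm (\<Sum>i\<in>K. smul (c i) (f i)) < \<epsilon>" if K: "finite K" "K \<subseteq> J" "K \<inter> F = {}" for K
  proof -
    have "(\<Sum>i\<in>K. (norm (c i))\<^sup>2) + (\<Sum>i\<in>F. (norm (c i))\<^sup>2) = (\<Sum>i\<in>K \<union> F. (norm (c i))\<^sup>2)"
      using K F by (simp add: sum.union_disjoint)
    also have "\<dots> \<le> (\<Sum>\<^sub>\<infinity>i\<in>J. (norm (c i))\<^sup>2)"
      using K F by (intro finite_sum_le_infsum c) auto
    finally have le_\<delta>: "(\<Sum>i\<in>K. (norm (c i))\<^sup>2) \<le> \<delta>"
      using near by (simp add: dist_real_def)
    have "(norm (\<Sum>i\<in>K. smul (c i) (f i)))\<^sup>2 \<le> B * (\<Sum>i\<in>K. (norm (c i))\<^sup>2)"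
      using K by (intro bessel_boundD[OF bessel])
    also have "\<dots> \<le> B * \<delta>"
      using \<open>0 < B\<close> le_\<delta> by simp
    also have "\<dots> < \<epsilon>\<^sup>2"
      using \<open>0 < B\<close> \<open>\<epsilon> > 0\<close> by (simp add: \<delta>_def)
    finally show ?thesis
      using \<open>\<epsilon> > 0\<close> by (simp add: power_less_imp_less_base)
  qed
  then show "\<exists>F. finite F \<and> F \<subseteq> J \<and> (\<forall>K. finite K \<and> K \<subseteq> J \<and> K \<inter> F = {} \<longrightarrow>
      norm (\<Sum>i\<in>K. smul (c i) (f i)) < \<epsilon>)"
    using F by blast
qed

lemma
  assumes sum: "(\<lambda>i. smul (c i) (f i)) summable_on J"
    and c: "(\<lambda>i. (norm (c i))\<^sup>2) summable_on J"
  shows synthesis_norm_le: "bessel_bound B f J \<Longrightarrow>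
      (norm (\<Sum>\<^sub>\<infinity>i\<in>J. smul (c i) (f i)))\<^sup>2 \<le> B * (\<Sum>\<^sub>\<infinity>i\<in>J. (norm (c i))\<^sup>2)"
    and synthesis_norm_ge: "lower_riesz_bound A f J \<Longrightarrow>
      A * (\<Sum>\<^sub>\<infinity>i\<in>J. (norm (c i))\<^sup>2) \<le> (norm (\<Sum>\<^sub>\<infinity>i\<in>J. smul (c i) (f i)))\<^sup>2"
proof -
  have "((\<lambda>K. \<Sum>i\<in>K. smul (c i) (f i)) \<longlongrightarrow> (\<Sum>\<^sub>\<infinity>i\<in>J. smul (c i) (f i))) (finite_subsets_at_top J)"
    using has_sum_infsum[OF sum] by (simp add: has_sum_def)
  then have lim1: "((\<lambda>K. (norm (\<Sum>i\<in>K. smul (c i) (f i)))\<^sup>2) \<longlongrightarrow>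
      (norm (\<Sum>\<^sub>\<infinity>i\<in>J. smul (c i) (f i)))\<^sup>2) (finite_subsets_at_top J)"
    by (intro tendsto_intros)
  have "((\<lambda>K. \<Sum>i\<in>K. (norm (c i))\<^sup>2) \<longlongrightarrow> (\<Sum>\<^sub>\<infinity>i\<in>J. (norm (c i))\<^sup>2)) (finite_subsets_at_top J)"
    using has_sum_infsum[OF c] by (simp add: has_sum_def)
  then have lim2: "((\<lambda>K. b * (\<Sum>i\<in>K. (norm (c i))\<^sup>2)) \<longlongrightarrow> b * (\<Sum>\<^sub>\<infinity>i\<in>J. (norm (c i))\<^sup>2))
      (finite_subsets_at_top J)" for b
    by (intro tendsto_intros)
  show "(norm (\<Sum>\<^sub>\<infinity>i\<in>J. smul (c i) (f i)))\<^sup>2 \<le> B * (\<Sum>\<^sub>\<infinity>i\<in>J. (norm (c i))\<^sup>2)"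
    if "bessel_bound B f J"
    by (rule tendsto_le[OF _ lim2 lim1])
       (auto intro!: eventually_finite_subsets_at_top_weakI bessel_boundD[OF that])
  show "A * (\<Sum>\<^sub>\<infinity>i\<in>J. (norm (c i))\<^sup>2) \<le> (norm (\<Sum>\<^sub>\<infinity>i\<in>J. smul (c i) (f i)))\<^sup>2"
    if "lower_riesz_bound A f J"
    by (rule tendsto_le[OF _ lim1 lim2])
       (auto intro!: eventually_finite_subsets_at_top_weakI lower_riesz_boundD[OF that])
qed

text \<open>Analysis is the adjoint of synthesis, so it has the same norm: pairing \<open>x\<close> with the
  combination of the \<open>f i\<close> whose coefficients are \<open>ip x (f i)\<close> gives the sum of squares itself.\<close>

lemma analysis_finite:
  assumes bessel: "bessel_bound B f J" and "0 < B" and K: "finite K" "K \<subseteq> J"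
  shows "(\<Sum>i\<in>K. (norm (ip x (f i)))\<^sup>2) \<le> B * (norm x)\<^sup>2"
proof -
  define s where "s = (\<Sum>i\<in>K. (norm (ip x (f i)))\<^sup>2)"
  define z where "z = (\<Sum>i\<in>K. smul (ip x (f i)) (f i))"
  have "s \<ge> 0" unfolding s_def by (simp add: sum_nonneg)
  have "ip z x = of_real s"
    by (simp add: z_def s_def ip_combination_left ip_commute[of "f _" x] mult_conjg_of_real)
  then have "s = norm (ip z x)" using \<open>s \<ge> 0\<close> by simp
  also have "\<dots> \<le> norm z * norm x" by (rule Cauchy_Schwarz)
  finally have "s\<^sup>2 \<le> (norm z)\<^sup>2 * (norm x)\<^sup>2"
    using \<open>s \<ge> 0\<close> by (metis power_mono power_mult_distrib)
  also have "\<dots> \<le> (B * s) * (norm x)\<^sup>2"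
    unfolding z_def s_def by (intro mult_right_mono bessel_boundD[OF bessel] K) simp
  finally have "s * s \<le> s * (B * (norm x)\<^sup>2)"
    by (simp add: power2_eq_square mult_ac)
  moreover have "0 \<le> B * (norm x)\<^sup>2" using \<open>0 < B\<close> by simp
  ultimately show ?thesis
    unfolding s_def[symmetric] using \<open>s \<ge> 0\<close> by (cases "s = 0") (simp_all)
qed

lemma
  assumes "bessel_bound B f J" and "0 < B"
  shows analysis_summable: "(\<lambda>i. (norm (ip x (f i)))\<^sup>2) summable_on J"
    and analysis_infsum_le: "(\<Sum>\<^sub>\<infinity>i\<in>J. (norm (ip x (f i)))\<^sup>2) \<le> B * (norm x)\<^sup>2"
proof -
  show *: "(\<lambda>i. (norm (ip x (f i)))\<^sup>2) summable_on J"
    by (intro nonneg_bdd_above_summable_on bdd_aboveI[of _ "B * (norm x)\<^sup>2"])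
       (auto intro!: analysis_finite[OF assms])
  show "(\<Sum>\<^sub>\<infinity>i\<in>J. (norm (ip x (f i)))\<^sup>2) \<le> B * (norm x)\<^sup>2"
    using * by (rule infsum_le_finite_sums) (rule analysis_finite[OF assms])
qed

text \<open>The converse duality: an upper frame bound on a subspace containing the frame vectors bounds
  the norm of each finite combination \<open>x\<close>, which is obtained by pairing \<open>x\<close> with itself.\<close>

lemma bessel_bound_if_analysis_le:
  assumes V: "subspace V" "f ` J \<subseteq> V" and "0 < B"
    and analysis: "\<And>x. x \<in> V \<Longrightarrow> (\<lambda>i. (norm (ip x (f i)))\<^sup>2) summable_on J \<and>
              (\<Sum>\<^sub>\<infinity>i\<in>J. (norm (ip x (f i)))\<^sup>2) \<le> B * (norm x)\<^sup>2"
  shows "bessel_bound B f J"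
  unfolding bessel_bound_def
proof (intro allI impI)
  fix K c assume K: "finite K" "K \<subseteq> J"
  define x where "x = (\<Sum>i\<in>K. smul (c i) (f i))"
  define s where "s = (\<Sum>i\<in>K. (norm (c i))\<^sup>2)"
  have "x \<in> V"
    unfolding x_def using V K by (intro subspace_sum subspace_scale) auto
  have "(\<Sum>i\<in>K. (norm (ip x (f i)))\<^sup>2) \<le> (\<Sum>\<^sub>\<infinity>i\<in>J. (norm (ip x (f i)))\<^sup>2)"
    using analysis[OF \<open>x \<in> V\<close>] K by (intro finite_sum_le_infsum) auto
  also have "\<dots> \<le> B * (norm x)\<^sup>2" using analysis[OF \<open>x \<in> V\<close>] by blast
  finally have coeffs: "(\<Sum>i\<in>K. (norm (ip x (f i)))\<^sup>2) \<le> B * (norm x)\<^sup>2" .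
  have "(norm x)\<^sup>2 = norm (ip x x)" by (simp add: ip_self norm_power)
  also have "ip x x = (\<Sum>i\<in>K. c i * ip (f i) x)"
    by (subst (1) x_def) (rule ip_combination_left)
  also have "norm \<dots> \<le> (\<Sum>i\<in>K. norm (c i) * norm (ip x (f i)))"
    by (rule sum_norm_le) (simp add: norm_mult norm_ip_commute)
  finally have "((norm x)\<^sup>2)\<^sup>2 \<le> (\<Sum>i\<in>K. norm (c i) * norm (ip x (f i)))\<^sup>2"
    by (intro power_mono) auto
  also have "\<dots> \<le> s * (\<Sum>i\<in>K. (norm (ip x (f i)))\<^sup>2)"
    unfolding s_def by (rule Cauchy_Schwarz_ineq_sum)
  also have "\<dots> \<le> s * (B * (norm x)\<^sup>2)"
    by (intro mult_left_mono coeffs) (simp add: s_def sum_nonneg)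
  finally have "(norm x)\<^sup>2 * (norm x)\<^sup>2 \<le> (norm x)\<^sup>2 * (B * s)"
    by (simp add: power2_eq_square mult_ac)
  moreover have "0 \<le> B * s" using \<open>0 < B\<close> by (simp add: s_def sum_nonneg)
  ultimately have "(norm x)\<^sup>2 \<le> B * s"
    using mult_le_cancel_left_pos[of "(norm x)\<^sup>2" "(norm x)\<^sup>2" "B * s"] by (cases "x = 0") auto
  then show "(norm (\<Sum>i\<in>K. smul (c i) (f i)))\<^sup>2 \<le> B * (\<Sum>i\<in>K. (norm (c i))\<^sup>2)"
    by (simp add: x_def s_def)
qed

text \<open>Analysis against \<open>g\<close> followed by synthesis along \<open>f\<close>. For \<open>g = f\<close> this is the frame operator; for
  an orthonormal basis \<open>g\<close> it is the operator that sends \<open>g i\<close> to \<open>f i\<close>.\<close>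

definition cross_operator :: "('i \<Rightarrow> 'v) \<Rightarrow> ('i \<Rightarrow> 'v) \<Rightarrow> 'i set \<Rightarrow> 'v \<Rightarrow> 'v" where
  "cross_operator g f J x = (\<Sum>\<^sub>\<infinity>i\<in>J. smul (ip x (g i)) (f i))"

context
  fixes g f :: "'i \<Rightarrow> 'v" and J :: "'i set" and C B :: real
  assumes g_bessel: "bessel_bound C g J" and C_pos: "0 < C"
    and f_bessel: "bessel_bound B f J" and B_pos: "0 < B"
begin

lemma cross_operator_has_sum: "((\<lambda>i. smul (ip x (g i)) (f i)) has_sum cross_operator g f J x) J"
  unfolding cross_operator_def
  by (rule has_sum_infsum[OF synthesis_summable[OF f_bessel B_pos
          analysis_summable[OF g_bessel C_pos]]])

lemma cross_operator_add:
  "cross_operator g f J (x + y) = cross_operator g f J x + cross_operator g f J y"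
proof (rule has_sum_unique[OF cross_operator_has_sum])
  show "((\<lambda>i. smul (ip (x + y) (g i)) (f i)) has_sum
      cross_operator g f J x + cross_operator g f J y) J"
    using has_sum_add[OF cross_operator_has_sum cross_operator_has_sum]
    by (simp add: ip_add_left scale_left_distrib)
qed

lemma cross_operator_smul: "cross_operator g f J (smul c x) = smul c (cross_operator g f J x)"
proof (rule has_sum_unique[OF cross_operator_has_sum])
  show "((\<lambda>i. smul (ip (smul c x) (g i)) (f i)) has_sum smul c (cross_operator g f J x)) J"
    using has_sum_bounded_linear[OF bounded_linear_smul_right cross_operator_has_sum]
    by (simp add: ip_scale_left)
qed

lemma norm_cross_operator_le_analysis:
  "(norm (cross_operator g f J x))\<^sup>2 \<le> B * (\<Sum>\<^sub>\<infinity>i\<in>J. (norm (ip x (g i)))\<^sup>2)"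
  unfolding cross_operator_def
  by (rule synthesis_norm_le[OF synthesis_summable[OF f_bessel B_pos] _ f_bessel])
     (rule analysis_summable[OF g_bessel C_pos])+

lemma norm_cross_operator_ge_analysis:
  assumes "lower_riesz_bound A f J"
  shows "A * (\<Sum>\<^sub>\<infinity>i\<in>J. (norm (ip x (g i)))\<^sup>2) \<le> (norm (cross_operator g f J x))\<^sup>2"
  unfolding cross_operator_def
  by (rule synthesis_norm_ge[OF synthesis_summable[OF f_bessel B_pos] _ assms])
     (rule analysis_summable[OF g_bessel C_pos])+

lemma norm_cross_operator_le: "(norm (cross_operator g f J x))\<^sup>2 \<le> B * C * (norm x)\<^sup>2"
proof -
  have "B * (\<Sum>\<^sub>\<infinity>i\<in>J. (norm (ip x (g i)))\<^sup>2) \<le> B * (C * (norm x)\<^sup>2)"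
    by (rule mult_left_mono[OF analysis_infsum_le[OF g_bessel C_pos] less_imp_le[OF B_pos]])
  also have "\<dots> = B * C * (norm x)\<^sup>2" by simp
  finally show ?thesis by (rule order_trans[OF norm_cross_operator_le_analysis])
qed

lemma bounded_linear_cross_operator: "bounded_linear (cross_operator g f J)"
proof (rule bounded_linear_intro)
  show "cross_operator g f J (r *\<^sub>R x) = r *\<^sub>R cross_operator g f J x" for r x
    using cross_operator_smul[of "of_real r" x] by (simp add: scale_of_real)
  show "norm (cross_operator g f J x) \<le> norm x * sqrt (B * C)" for x
  proof (rule power2_le_imp_le)
    show "(norm (cross_operator g f J x))\<^sup>2 \<le> (norm x * sqrt (B * C))\<^sup>2"
      using norm_cross_operator_le[of x] B_pos C_pos
      by (simp add: power_mult_distrib mult.commute)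
  qed (use B_pos C_pos in simp)
qed (rule cross_operator_add)

lemma cross_operator_in_closed_span: "cross_operator g f J x \<in> closed_span smul (f ` J)"
  unfolding cross_operator_def using closed_span_superset
  by (intro infsum_in_closed_span subspace_scale[OF subspace_closed_span]) blast

end

section \<open>The frame operator\<close>

lemma frame_operator_eq_cross_operator: "frame_operator smul ip f I = cross_operator f f I"
  by (rule ext) (simp add: frame_operator_def cross_operator_def)

context
  fixes f :: "'i \<Rightarrow> 'v" and I :: "'i set" and B :: real
  assumes bessel: "bessel_bound B f I" and B_pos: "0 < B"
begin

lemmas frame_operator_has_sum =
    cross_operator_has_sum[OF bessel B_pos bessel B_pos, folded frame_operator_eq_cross_operator]
  and frame_operator_add =
    cross_operator_add[OF bessel B_pos bessel B_pos, folded frame_operator_eq_cross_operator]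
  and frame_operator_smul =
    cross_operator_smul[OF bessel B_pos bessel B_pos, folded frame_operator_eq_cross_operator]
  and norm_frame_operator_le_analysis =
    norm_cross_operator_le_analysis[OF bessel B_pos bessel B_pos,
      folded frame_operator_eq_cross_operator]
  and norm_frame_operator_le =
    norm_cross_operator_le[OF bessel B_pos bessel B_pos, folded frame_operator_eq_cross_operator]
  and frame_operator_in_closed_span =
    cross_operator_in_closed_span[OF bessel B_pos bessel B_pos,
      folded frame_operator_eq_cross_operator]

lemma frame_operator_diff:
  "frame_operator smul ip f I (x - y) = frame_operator smul ip f I x - frame_operator smul ip f I y"
  using frame_operator_add[of "x - y" y] by simp

lemma frame_operator_combination:
  assumes "finite K"
  shows "frame_operator smul ip f I (\<Sum>i\<in>K. smul (c i) (g i)) =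
     (\<Sum>i\<in>K. smul (c i) (frame_operator smul ip f I (g i)))"
  using assms
proof (induction K rule: finite_induct)
  case empty
  then show ?case using frame_operator_diff[of 0 0] by simp
next
  case (insert k K)
  then show ?case by (simp add: frame_operator_add frame_operator_smul)
qed

lemma ip_frame_operator_self:
  "ip (frame_operator smul ip f I x) x = of_real (\<Sum>\<^sub>\<infinity>i\<in>I. (norm (ip x (f i)))\<^sup>2)"
proof (rule has_sum_unique)
  show "((\<lambda>i. ip (smul (ip x (f i)) (f i)) x) has_sum ip (frame_operator smul ip f I x) x) I"
    by (rule has_sum_bounded_linear[OF bounded_linear_ip_left frame_operator_has_sum])
  have "((\<lambda>i. of_real ((norm (ip x (f i)))\<^sup>2) :: 'k) has_sum
      of_real (\<Sum>\<^sub>\<infinity>i\<in>I. (norm (ip x (f i)))\<^sup>2)) I"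
    by (intro has_sum_bounded_linear[OF bounded_linear_of_real] has_sum_infsum
        analysis_summable[OF bessel B_pos])
  moreover have "ip (smul (ip x (f i)) (f i)) x = of_real ((norm (ip x (f i)))\<^sup>2)" for i
    by (simp add: ip_scale_left ip_commute[of "f i" x] mult_conjg_of_real)
  ultimately show "((\<lambda>i. ip (smul (ip x (f i)) (f i)) x) has_sum
      of_real (\<Sum>\<^sub>\<infinity>i\<in>I. (norm (ip x (f i)))\<^sup>2)) I"
    by presburger
qed

text \<open>On the closed span the frame operator \<open>S\<close> is coercive, so for small \<open>t > 0\<close> the map
  \<open>x \<mapsto> x - t (S x - y)\<close> is a contraction; its fixed point solves \<open>S x = y\<close>.\<close>

lemma frame_operator_surj:
  assumes "0 < A" and y: "y \<in> closed_span smul (f ` I)"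
    and lower: "\<And>x. x \<in> closed_span smul (f ` I) \<Longrightarrow>
        A * (norm x)\<^sup>2 \<le> (\<Sum>\<^sub>\<infinity>i\<in>I. (norm (ip x (f i)))\<^sup>2)"
  shows "\<exists>x\<in>closed_span smul (f ` I). frame_operator smul ip f I x = y"
proof -
  let ?V = "closed_span smul (f ` I)" and ?S = "frame_operator smul ip f I"
  \<comment> \<open>Coercivity and \<open>norm (S x) \<le> B * norm x\<close> bound the squared contraction factor by
    \<open>1 - 2 t A + t\<^sup>2 B\<^sup>2\<close>; this \<open>t\<close> is its minimizer and \<open>q\<close> its minimum.\<close>
  define t where "t = A / B\<^sup>2"
  define q where "q = (1 - A\<^sup>2 / B\<^sup>2)"
  have t_pos: "t > 0" using \<open>0 < A\<close> B_pos by (simp add: t_def)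
  have contract: "(norm (x - smul (of_real t) (?S x)))\<^sup>2 \<le> q * (norm x)\<^sup>2" if "x \<in> ?V" for x
  proof -
    define r where "r = (\<Sum>\<^sub>\<infinity>i\<in>I. (norm (ip x (f i)))\<^sup>2)"
    have Sx: "ip (?S x) x = of_real r" "ip x (?S x) = of_real r"
    proof -
      show Sx: "ip (?S x) x = of_real r" by (simp only: ip_frame_operator_self r_def)
      show "ip x (?S x) = of_real r"
        by (rule trans[OF ip_commute]) (simp only: Sx conjg_of_real)
    qed
    have "of_real ((norm (x - smul (of_real t) (?S x)))\<^sup>2) =
        (of_real ((norm x)\<^sup>2 - 2 * t * r + t\<^sup>2 * (norm (?S x))\<^sup>2) :: 'k)"
    proof -
      let ?w = "smul (of_real t) (?S x)"
      have "ip (x - ?w) (x - ?w) = ip x x - ip x ?w - ip ?w x + ip ?w ?w"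
        by (simp only: ip_diff_left ip_diff_right) simp
      also have "\<dots> = of_real ((norm x)\<^sup>2) - of_real t * of_real r - of_real t * of_real r
          + of_real t * (of_real t * of_real ((norm (?S x))\<^sup>2))"
        by (simp only: ip_scale_left ip_scale_right Sx conjg_of_real ip_self[symmetric])
      finally show ?thesis
        by (simp only: ip_self) (simp add: power2_eq_square)
    qed
    then have "(norm (x - smul (of_real t) (?S x)))\<^sup>2 =
        (norm x)\<^sup>2 - 2 * t * r + t\<^sup>2 * (norm (?S x))\<^sup>2"
      by (simp only: of_real_eq_iff)
    also have "\<dots> \<le> (norm x)\<^sup>2 - 2 * t * (A * (norm x)\<^sup>2) + t\<^sup>2 * (B * B * (norm x)\<^sup>2)"
      using t_pos lower[OF that] norm_frame_operator_le[of x]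
      by (intro add_mono diff_left_mono mult_left_mono order_refl) (auto simp: r_def)
    also have "\<dots> = q * (norm x)\<^sup>2"
      using B_pos by (simp add: q_def t_def field_simps power2_eq_square)
    finally show ?thesis .
  qed
  \<comment> \<open>\<open>A \<le> B\<close> is only known when \<open>V\<close> contains a nonzero vector, so \<open>q\<close> may be negative.\<close>
  define c where "c = sqrt (max 0 q)"
  have c: "0 \<le> c" "c < 1" "c\<^sup>2 \<ge> q"
    using \<open>0 < A\<close> B_pos by (auto simp: c_def q_def)
  have "\<exists>!x\<in>?V. x - smul (of_real t) (?S x - y) = x"
  proof (rule Banach_fix[OF _ _ c(1,2)])
    show "complete ?V" using closed_closed_span complete_eq_closed by blast
    show "?V \<noteq> {}" using y by blast
    show "(\<lambda>x. x - smul (of_real t) (?S x - y)) ` ?V \<subseteq> ?V"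
      by (intro image_subsetI subspace_diff[OF subspace_closed_span]
          subspace_scale[OF subspace_closed_span] y frame_operator_in_closed_span)
    show "dist (x - smul (of_real t) (?S x - y)) (x' - smul (of_real t) (?S x' - y)) \<le> c * dist x x'"
      if "x \<in> ?V" "x' \<in> ?V" for x x'
    proof -
      have "x - x' \<in> ?V" using that subspace_diff[OF subspace_closed_span] by blast
      have "(x - smul (of_real t) (?S x - y)) - (x' - smul (of_real t) (?S x' - y)) =
          (x - x') - smul (of_real t) (?S (x - x'))"
        by (simp add: frame_operator_diff scale_right_diff_distrib)
      then have "(dist (x - smul (of_real t) (?S x - y)) (x' - smul (of_real t) (?S x' - y)))\<^sup>2
          \<le> q * (norm (x - x'))\<^sup>2"
        using contract[OF \<open>x - x' \<in> ?V\<close>] by (simp only: dist_norm)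
      also have "\<dots> \<le> (c * dist x x')\<^sup>2"
        using c by (simp add: power_mult_distrib dist_norm mult_right_mono)
      finally show ?thesis by (rule power2_le_imp_le) (use c in simp)
    qed
  qed
  then obtain x where "x \<in> ?V" "x - smul (of_real t) (?S x - y) = x" by blast
  then show ?thesis using t_pos by auto
qed

end

end

section \<open>Diagonally dominant cross-Gram matrices\<close>

text \<open>Schur's test with unit weights: as
  \<open>\<bar>c i\<bar> \<bar>c j\<bar> \<le> (\<bar>c i\<bar>\<^sup>2 + \<bar>c j\<bar>\<^sup>2) / 2\<close>, the off-diagonal part of the form is controlled by its
  absolute row sums and column sums.\<close>

lemma diagonally_dominant_form_ge:
  fixes M :: "'i \<Rightarrow> 'i \<Rightarrow> 'k::rc_field"
  assumes "finite K"
    and diag: "\<And>i. i \<in> K \<Longrightarrow> M i i = of_real (t i)" "\<And>i. i \<in> K \<Longrightarrow> \<delta> \<le> t i" and "0 \<le> \<delta>"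
    and rows: "\<And>i. i \<in> K \<Longrightarrow> (\<Sum>j\<in>K - {i}. norm (M i j)) \<le> \<epsilon>"
    and cols: "\<And>i. i \<in> K \<Longrightarrow> (\<Sum>j\<in>K - {i}. norm (M j i)) \<le> \<epsilon>"
  shows "(\<delta> - \<epsilon>) * (\<Sum>i\<in>K. (norm (c i))\<^sup>2) \<le> norm (\<Sum>i\<in>K. \<Sum>j\<in>K. c i * conjg (c j) * M i j)"
proof -
  define N where "N i j = (if i = j then 0 else norm (M i j))" for i j
  define D where "D = (\<Sum>i\<in>K. (norm (c i))\<^sup>2 * t i)"
  define R where "R = (\<Sum>i\<in>K. \<Sum>j\<in>K. if i = j then 0 else c i * conjg (c j) * M i j)"
  have N_rows: "(\<Sum>j\<in>K. N i j) \<le> \<epsilon>" and N_cols: "(\<Sum>j\<in>K. N j i) \<le> \<epsilon>" if "i \<in> K" for i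
  proof -
    have "(\<Sum>j\<in>K. N i j) = (\<Sum>j\<in>K - {i}. norm (M i j))"
      "(\<Sum>j\<in>K. N j i) = (\<Sum>j\<in>K - {i}. norm (M j i))"
      using \<open>finite K\<close> by (auto intro!: sum.mono_neutral_cong_right simp: N_def split: if_splits)
    then show "(\<Sum>j\<in>K. N i j) \<le> \<epsilon>" "(\<Sum>j\<in>K. N j i) \<le> \<epsilon>"
      using rows[OF that] cols[OF that] by simp_all
  qed
  have "norm R \<le> (\<Sum>i\<in>K. \<Sum>j\<in>K. ((norm (c i))\<^sup>2 * N i j + (norm (c j))\<^sup>2 * N i j) / 2)"
    unfolding R_def
  proof (intro sum_norm_le)
    fix i j
    have "2 * (norm (c i) * norm (c j)) \<le> (norm (c i))\<^sup>2 + (norm (c j))\<^sup>2"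
      using sum_squares_bound[of "norm (c i)" "norm (c j)"] by (simp add: mult.assoc)
    then have "norm (c i) * norm (c j) * N i j \<le> ((norm (c i))\<^sup>2 + (norm (c j))\<^sup>2) / 2 * N i j"
      by (intro mult_right_mono) (auto simp: N_def)
    then show "norm (if i = j then 0 else c i * conjg (c j) * M i j) \<le>
        ((norm (c i))\<^sup>2 * N i j + (norm (c j))\<^sup>2 * N i j) / 2"
      by (cases "i = j") (simp_all add: N_def norm_mult algebra_simps)
  qed
  also have "\<dots> = ((\<Sum>i\<in>K. (norm (c i))\<^sup>2 * (\<Sum>j\<in>K. N i j)) +
      (\<Sum>j\<in>K. (norm (c j))\<^sup>2 * (\<Sum>i\<in>K. N i j))) / 2"
  proof -
    have "(\<Sum>i\<in>K. \<Sum>j\<in>K. (norm (c j))\<^sup>2 * N i j) = (\<Sum>j\<in>K. \<Sum>i\<in>K. (norm (c j))\<^sup>2 * N i j)"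
      by (rule sum.swap)
    then show ?thesis
      by (simp add: sum.distrib sum_distrib_left flip: sum_divide_distrib)
  qed
  also have "\<dots> \<le> ((\<Sum>i\<in>K. (norm (c i))\<^sup>2 * \<epsilon>) + (\<Sum>j\<in>K. (norm (c j))\<^sup>2 * \<epsilon>)) / 2"
    by (intro divide_right_mono add_mono sum_mono mult_left_mono N_rows N_cols) simp_all
  also have "\<dots> = \<epsilon> * (\<Sum>i\<in>K. (norm (c i))\<^sup>2)"
    by (simp add: sum_distrib_left mult.commute)
  finally have R: "norm R \<le> \<epsilon> * (\<Sum>i\<in>K. (norm (c i))\<^sup>2)" .
  have "(\<Sum>i\<in>K. \<Sum>j\<in>K. c i * conjg (c j) * M i j) = of_real D + R"
  proof -
    have "of_real D = (\<Sum>i\<in>K. \<Sum>j\<in>K. if i = j then c i * conjg (c j) * M i j else 0)"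
      using \<open>finite K\<close> by (simp add: D_def mult_conjg_of_real diag(1) cong: sum.cong)
    then show ?thesis
      unfolding R_def by (simp only: sum.distrib[symmetric]) (intro sum.cong refl, auto)
  qed
  moreover have "norm (of_real D :: 'k) \<le> norm (of_real D + R) + norm R"
    using norm_triangle_ineq4[of "of_real D + R" R] by simp
  moreover have "\<delta> * (\<Sum>i\<in>K. (norm (c i))\<^sup>2) \<le> D"
    unfolding D_def sum_distrib_left
    by (intro sum_mono) (simp add: diag(2) mult.commute[of \<delta>] mult_left_mono)
  ultimately show ?thesis
    using R by (simp add: left_diff_distrib)
qed

context hilbert_space
begin

context
  fixes f :: "'i \<Rightarrow> 'v" and I :: "'i set" and A B :: real
  assumes bessel: "bessel_bound B f I" and B_pos: "0 < B" and A_pos: "0 < A"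
    and lower: "\<And>x. x \<in> closed_span smul (f ` I) \<Longrightarrow>
        A * (norm x)\<^sup>2 \<le> (\<Sum>\<^sub>\<infinity>i\<in>I. (norm (ip x (f i)))\<^sup>2)"
begin

text \<open>The canonical dual is defined through \<open>inv_into\<close>; surjectivity of the frame operator makes it a
  genuine preimage.\<close>

lemma
  assumes "i \<in> I"
  shows frame_operator_canonical_dual:
      "frame_operator smul ip f I (canonical_dual smul ip f I i) = f i"
    and canonical_dual_in_closed_span: "canonical_dual smul ip f I i \<in> closed_span smul (f ` I)"
proof -
  have "f i \<in> closed_span smul (f ` I)"
    using closed_span_superset assms by blast
  then obtain x where "x \<in> closed_span smul (f ` I)" "frame_operator smul ip f I x = f i"
    using frame_operator_surj[OF bessel B_pos A_pos _ lower] by blast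
  then have *: "f i \<in> frame_operator smul ip f I ` closed_span smul (f ` I)"
    by (metis image_eqI)
  show "frame_operator smul ip f I (canonical_dual smul ip f I i) = f i"
    unfolding canonical_dual_def by (rule f_inv_into_f[OF *])
  show "canonical_dual smul ip f I i \<in> closed_span smul (f ` I)"
    unfolding canonical_dual_def by (rule inv_into_into[OF *])
qed

text \<open>With \<open>x = S y\<close> this bounds the form of the inverse, \<open>ip x (S\<^sup>-\<^sup>1 x)\<close>, by \<open>(norm x)\<^sup>2 / A\<close>.
  Coercivity gives \<open>A * norm y \<le> norm (S y)\<close>, and Cauchy-Schwarz does the rest.\<close>

lemma ip_frame_operator_inverse_le:
  assumes "y \<in> closed_span smul (f ` I)"
  shows "A * norm (ip (frame_operator smul ip f I y) y) \<le> (norm (frame_operator smul ip f I y))\<^sup>2"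
proof -
  let ?S = "frame_operator smul ip f I"
  define q where "q = norm (ip (?S y) y)"
  have "q = (\<Sum>\<^sub>\<infinity>i\<in>I. (norm (ip y (f i)))\<^sup>2)"
    unfolding q_def ip_frame_operator_self[OF bessel B_pos]
    by (simp add: infsum_nonneg)
  then have Aq: "A * (norm y)\<^sup>2 \<le> q" using lower[OF assms] by simp
  have q_le: "q \<le> norm (?S y) * norm y" unfolding q_def by (rule Cauchy_Schwarz)
  have "A * norm y \<le> norm (?S y)"
  proof (cases "y = 0")
    case False
    have "(A * norm y) * norm y \<le> norm (?S y) * norm y"
      using Aq q_le by (simp add: power2_eq_square mult.assoc)
    then show ?thesis using False by simp
  qed simp
  then have "norm (?S y) * (A * norm y) \<le> norm (?S y) * norm (?S y)"
    by (rule mult_left_mono) simp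
  moreover have "A * q \<le> A * (norm (?S y) * norm y)"
    using q_le A_pos by simp
  ultimately show ?thesis unfolding q_def by (simp add: power2_eq_square mult_ac)
qed

text \<open>With \<open>y\<close> the dual vector, so that \<open>S y = f i\<close>, the inner product is the sum of the squared
  coefficients \<open>ip y (f k)\<close>, and \<open>f i\<close> is the synthesis of these coefficients.\<close>

lemma ip_canonical_dual_self:
  assumes "i \<in> I"
  shows "\<exists>t. ip (f i) (canonical_dual smul ip f I i) = of_real t \<and> (norm (f i))\<^sup>2 / B \<le> t"
  using ip_frame_operator_self[OF bessel B_pos, of "canonical_dual smul ip f I i"]
    norm_frame_operator_le_analysis[OF bessel B_pos, of "canonical_dual smul ip f I i"] B_pos
  unfolding frame_operator_canonical_dual[OF assms] by (auto simp: field_simps)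

text \<open>If \<open>x\<close> is a finite combination of the \<open>f i\<close>, then \<open>S\<^sup>-\<^sup>1 x\<close> is the same combination of the
  canonical dual vectors \<open>f~ i = S\<^sup>-\<^sup>1 (f i)\<close>, so \<open>ip x (S\<^sup>-\<^sup>1 x)\<close> is the value at the
  coefficients of the form with matrix \<open>ip (f i) (f~ j)\<close>; it is at most \<open>(norm x)\<^sup>2 / A\<close>, and at least a multiple of the sum of
  squares of the coefficients when the matrix is diagonally dominant.\<close>

lemma lower_riesz_bound_if_diagonally_dominant:
  assumes "J \<subseteq> I" and norms: "\<And>i. i \<in> J \<Longrightarrow> C \<le> norm (f i)" and "0 \<le> C"
    and rows: "\<And>i K. i \<in> J \<Longrightarrow> finite K \<Longrightarrow> K \<subseteq> J - {i} \<Longrightarrow>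
        (\<Sum>j\<in>K. norm (ip (f i) (canonical_dual smul ip f I j))) \<le> \<epsilon>"
    and cols: "\<And>i K. i \<in> J \<Longrightarrow> finite K \<Longrightarrow> K \<subseteq> J - {i} \<Longrightarrow>
        (\<Sum>j\<in>K. norm (ip (f j) (canonical_dual smul ip f I i))) \<le> \<epsilon>"
  shows "lower_riesz_bound (A * (C\<^sup>2 / B - \<epsilon>)) f J"
  unfolding lower_riesz_bound_def
proof (intro allI impI)
  fix K c assume K: "finite K" "K \<subseteq> J"
  let ?S = "frame_operator smul ip f I" and ?d = "canonical_dual smul ip f I"
  define x where "x = (\<Sum>i\<in>K. smul (c i) (f i))"
  define y where "y = (\<Sum>i\<in>K. smul (c i) (?d i))"
  have KI: "i \<in> I" if "i \<in> K" for i using that K \<open>J \<subseteq> I\<close> by blast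
  have y: "y \<in> closed_span smul (f ` I)"
    unfolding y_def by (intro subspace_sum[OF subspace_closed_span]
        subspace_scale[OF subspace_closed_span] canonical_dual_in_closed_span KI)
  have "?S y = x"
    unfolding x_def y_def frame_operator_combination[OF bessel B_pos K(1)]
    by (intro sum.cong refl) (simp add: frame_operator_canonical_dual KI)
  have "\<forall>i\<in>K. \<exists>t. ip (f i) (?d i) = of_real t \<and> (norm (f i))\<^sup>2 / B \<le> t"
    using ip_canonical_dual_self KI by blast
  then obtain t where t: "\<And>i. i \<in> K \<Longrightarrow> ip (f i) (?d i) = of_real (t i)"
      "\<And>i. i \<in> K \<Longrightarrow> (norm (f i))\<^sup>2 / B \<le> t i"
    by (metis (no_types, lifting) bchoice)
  have "(C\<^sup>2 / B - \<epsilon>) * (\<Sum>i\<in>K. (norm (c i))\<^sup>2) \<le>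
      norm (\<Sum>i\<in>K. \<Sum>j\<in>K. c i * conjg (c j) * ip (f i) (?d j))"
  proof (rule diagonally_dominant_form_ge[OF K(1) t(1)])
    show "C\<^sup>2 / B \<le> t i" if "i \<in> K" for i
    proof -
      have "C\<^sup>2 / B \<le> (norm (f i))\<^sup>2 / B"
        using norms[of i] that K \<open>0 \<le> C\<close> B_pos by (intro divide_right_mono power_mono) auto
      then show ?thesis using t(2)[OF that] by linarith
    qed
  qed (use K B_pos in \<open>auto intro!: rows cols\<close>)
  also have "(\<Sum>i\<in>K. \<Sum>j\<in>K. c i * conjg (c j) * ip (f i) (?d j)) = ip x y"
    unfolding x_def ip_combination_left unfolding y_def ip_combination_right
    by (simp add: sum_distrib_left mult.assoc)
  finally have "A * ((C\<^sup>2 / B - \<epsilon>) * (\<Sum>i\<in>K. (norm (c i))\<^sup>2)) \<le> A * norm (ip x y)"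
    using A_pos by simp
  also have "\<dots> \<le> (norm x)\<^sup>2"
    using ip_frame_operator_inverse_le[OF y] by (simp add: \<open>?S y = x\<close>)
  finally show "A * (C\<^sup>2 / B - \<epsilon>) * (\<Sum>i\<in>K. (norm (c i))\<^sup>2) \<le>
      (norm (\<Sum>i\<in>K. smul (c i) (f i)))\<^sup>2"
    by (simp add: x_def mult.assoc)
qed

end

end

section \<open>Gram-Schmidt orthogonalization\<close>

context hilbert_space
begin

text \<open>The vectors are not normalized. A zero vector arising on the way contributes nothing to later
  projections, whatever the value of the quotient by zero in its coefficient, so the recursion is
  correct for linearly dependent sequences too.\<close>

fun gram_schmidt :: "(nat \<Rightarrow> 'v) \<Rightarrow> nat \<Rightarrow> 'v" where
  "gram_schmidt v n = v n - (\<Sum>m<n. smul (ip (v n) (gram_schmidt v m) /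
     ip (gram_schmidt v m) (gram_schmidt v m)) (gram_schmidt v m))"

declare gram_schmidt.simps [simp del]

lemma gram_schmidt_zero: "v n = 0 \<Longrightarrow> gram_schmidt v n = 0"
  by (subst gram_schmidt.simps) simp

lemma gram_schmidt_orthogonal_less: "m < n \<Longrightarrow> ip (gram_schmidt v n) (gram_schmidt v m) = 0"
proof (induction n arbitrary: m rule: less_induct)
  case (less n)
  let ?g = "gram_schmidt v"
  have orth: "ip (?g k) (?g m) = 0" if "k < n" "k \<noteq> m" for k
  proof (cases "m < k")
    case True
    then show ?thesis using less.IH that by blast
  next
    case False
    then have "ip (?g m) (?g k) = 0" using less.IH[OF less.prems] that by simp
    then show ?thesis by (subst ip_commute) simp
  qed
  have "ip (?g n) (?g m) =
      ip (v n) (?g m) - (\<Sum>k<n. ip (v n) (?g k) / ip (?g k) (?g k) * ip (?g k) (?g m))"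
    by (subst (1) gram_schmidt.simps) (simp only: ip_diff_left ip_combination_left)
  also have "(\<Sum>k<n. ip (v n) (?g k) / ip (?g k) (?g k) * ip (?g k) (?g m)) =
      (\<Sum>k<n. if k = m then ip (v n) (?g m) / ip (?g m) (?g m) * ip (?g m) (?g m) else 0)"
    by (rule sum.cong) (simp_all add: orth)
  also have "\<dots> = ip (v n) (?g m) / ip (?g m) (?g m) * ip (?g m) (?g m)"
    using less.prems by simp
  also have "\<dots> = ip (v n) (?g m)"
    by (cases "?g m = 0") (simp_all add: ip_self)
  finally show ?case by simp
qed

lemma gram_schmidt_orthogonal: "m \<noteq> n \<Longrightarrow> ip (gram_schmidt v m) (gram_schmidt v n) = 0"
  using gram_schmidt_orthogonal_less[of m n v] gram_schmidt_orthogonal_less[of n m v]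
    ip_commute[of "gram_schmidt v m" "gram_schmidt v n"]
  by (cases "m < n") auto

lemma gram_schmidt_diff_in_span: "v n - gram_schmidt v n \<in> span (v ` {..<n})"
proof (induction n rule: less_induct)
  case (less n)
  have "gram_schmidt v m \<in> span (v ` {..<n})" if "m < n" for m
  proof -
    have "v m - gram_schmidt v m \<in> span (v ` {..<n})"
      using less.IH[OF that] span_mono[of "v ` {..<m}" "v ` {..<n}"] that by fastforce
    then have "v m - (v m - gram_schmidt v m) \<in> span (v ` {..<n})"
      by (rule span_diff[rotated]) (use that in \<open>auto intro: span_base\<close>)
    then show ?thesis by simp
  qed
  then show ?case
    by (subst gram_schmidt.simps) (auto intro!: span_sum span_scale)
qed

lemma gram_schmidt_in_span: "gram_schmidt v n \<in> span (range v)"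
proof -
  have "v n - gram_schmidt v n \<in> span (range v)"
    using gram_schmidt_diff_in_span[of v n] span_mono[of "v ` {..<n}" "range v"] by blast
  then have "v n - (v n - gram_schmidt v n) \<in> span (range v)"
    by (rule span_diff[rotated]) (auto intro: span_base)
  then show ?thesis by simp
qed

lemma in_span_gram_schmidt: "v n \<in> span (range (gram_schmidt v))"
proof -
  have "gram_schmidt v n + (\<Sum>m<n. smul (ip (v n) (gram_schmidt v m) /
      ip (gram_schmidt v m) (gram_schmidt v m)) (gram_schmidt v m)) \<in> span (range (gram_schmidt v))"
    by (intro span_add span_sum span_scale span_base) auto
  then show ?thesis by (subst (asm) (1) gram_schmidt.simps) simp
qed

text \<open>The combination is indexed by \<open>L\<close> and not by the vectors, since \<open>f\<close> may repeat values.\<close>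

lemma span_image_combination:
  assumes "x \<in> span (f ` L)"
  shows "\<exists>K c. finite K \<and> K \<subseteq> L \<and> x = (\<Sum>i\<in>K. smul (c i) (f i))"
  using assms
proof (induction rule: span_induct_alt)
  case base
  show ?case by (intro exI[of _ "{}"]) simp
next
  case (step b z y)
  then obtain l K c where l: "l \<in> L" "z = f l"
    and K: "finite K" "K \<subseteq> L" "y = (\<Sum>i\<in>K. smul (c i) (f i))" by blast
  define c' where "c' i = (if i = l then b else 0) + (if i \<in> K then c i else 0)" for i
  have "(\<Sum>i\<in>insert l K. smul (if i = l then b else 0) (f i)) = smul b (f l)"
    using K by (subst sum.mono_neutral_right[of _ "{l}"]) auto
  moreover have "(\<Sum>i\<in>insert l K. smul (if i \<in> K then c i else 0) (f i)) = y"
    unfolding K(3) using K by (intro sum.mono_neutral_cong_right) auto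
  ultimately have "smul b z + y = (\<Sum>i\<in>insert l K. smul (c' i) (f i))"
    by (simp only: c'_def scale_left_distrib sum.distrib l)
  then show ?case using K l by (intro exI[of _ "insert l K"] exI[of _ c']) auto
qed

text \<open>A linear relation expressing \<open>f j\<close> by the others is a vanishing combination with the
  coefficient \<open>-1\<close> at \<open>j\<close>, which the lower bound excludes.\<close>

lemma lower_riesz_bound_notin_span:
  assumes lower: "lower_riesz_bound A f J" and "0 < A" "j \<in> J"
  shows "f j \<notin> span (f ` (J - {j}))"
proof
  assume "f j \<in> span (f ` (J - {j}))"
  from span_image_combination[OF this]
  obtain K c where K: "finite K" "K \<subseteq> J - {j}" "f j = (\<Sum>i\<in>K. smul (c i) (f i))"
    by (elim exE conjE)
  define c' where "c' = c(j := - 1)"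
  have "j \<notin> K" using K by blast
  have "(\<Sum>i\<in>K. smul (c' i) (f i)) = f j"
    unfolding K(3) using \<open>j \<notin> K\<close> by (intro sum.cong) (auto simp: c'_def)
  then have "(\<Sum>i\<in>insert j K. smul (c' i) (f i)) = 0"
    using K(1) \<open>j \<notin> K\<close> by (simp add: c'_def)
  then have "A * (\<Sum>i\<in>insert j K. (norm (c' i))\<^sup>2) \<le> 0"
    using lower_riesz_boundD[OF lower, of "insert j K" c'] K \<open>j \<in> J\<close> by auto
  moreover have "(\<Sum>i\<in>insert j K. (norm (c' i))\<^sup>2) = 1 + (\<Sum>i\<in>K. (norm (c' i))\<^sup>2)"
    using K(1) \<open>j \<notin> K\<close> by (simp add: c'_def)
  moreover have "(\<Sum>i\<in>K. (norm (c' i))\<^sup>2) \<ge> 0" by (simp add: sum_nonneg)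
  ultimately show False using \<open>0 < A\<close> by (simp add: mult_le_0_iff)
qed

text \<open>A family with a lower Riesz bound is linearly independent, so Gram-Schmidt along an
  enumeration of \<open>J\<close> never produces a zero vector. The enumeration \<open>to_nat_on J\<close> may miss natural
  numbers; there the sequence is padded by \<open>0\<close>, which Gram-Schmidt ignores.\<close>

lemma orthonormal_basis_of_closed_span_exists:
  assumes lower: "lower_riesz_bound A f J" and "0 < A" and "countable J"
  shows "\<exists>e. orthonormal_basis_of smul ip (closed_span smul (f ` J)) e J"
proof -
  define \<nu> where "\<nu> = to_nat_on J"
  define v where "v n = (if n \<in> \<nu> ` J then f (from_nat_into J n) else 0)" for n
  define g where "g = gram_schmidt v"
  define e where "e j = smul (of_real (1 / norm (g (\<nu> j)))) (g (\<nu> j))" for j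
  have v: "v (\<nu> j) = f j" if "j \<in> J" for j
    using that \<open>countable J\<close> by (simp add: v_def \<nu>_def)
  have inj: "inj_on \<nu> J" using \<open>countable J\<close> by (simp add: \<nu>_def inj_on_to_nat_on)
  have g_nonzero: "g (\<nu> j) \<noteq> 0" if "j \<in> J" for j
  proof
    assume "g (\<nu> j) = 0"
    then have "f j \<in> span (v ` {..<\<nu> j})"
      using gram_schmidt_diff_in_span[of v "\<nu> j"] that by (simp add: v g_def)
    also have "v ` {..<\<nu> j} \<subseteq> insert 0 (f ` (J - {j}))"
    proof
      fix y assume "y \<in> v ` {..<\<nu> j}"
      then obtain n where n: "n < \<nu> j" "y = v n" by blast
      show "y \<in> insert 0 (f ` (J - {j}))"
      proof (cases "n \<in> \<nu> ` J")
        case True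
        then obtain i where "i \<in> J" "n = \<nu> i" by blast
        then show ?thesis using n v by auto
      qed (simp add: n v_def)
    qed
    then have "span (v ` {..<\<nu> j}) \<subseteq> span (f ` (J - {j}))"
      by (metis span_insert_0 span_mono)
    finally show False using lower_riesz_bound_notin_span[OF lower \<open>0 < A\<close> that] by blast
  qed
  have "ip (e i) (e j) = (if i = j then 1 else 0)" if "i \<in> J" "j \<in> J" for i j
  proof (cases "i = j")
    case True
    have "norm (e j) = 1"
      using g_nonzero[OF \<open>j \<in> J\<close>] by (simp add: e_def norm_smul norm_divide)
    then show ?thesis using True by (simp add: ip_self)
  next
    case False
    then have "\<nu> i \<noteq> \<nu> j" using inj that by (auto dest: inj_onD)
    then show ?thesis
      using False by (simp add: e_def g_def ip_scale_left ip_scale_right gram_schmidt_orthogonal)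
  qed
  moreover have "span (e ` J) = span (f ` J)"
  proof (rule span_eq[THEN iffD2], intro conjI)
    have "range v \<subseteq> insert 0 (f ` J)"
      using \<open>countable J\<close> by (auto simp: v_def \<nu>_def)
    then have "span (range v) \<subseteq> span (f ` J)" by (metis span_insert_0 span_mono)
    then show "e ` J \<subseteq> span (f ` J)"
      using gram_schmidt_in_span[of v] by (auto simp: e_def g_def intro!: span_scale)
    have "g n \<in> span (e ` J)" for n
    proof (cases "n \<in> \<nu> ` J")
      case True
      then obtain j where j: "j \<in> J" "n = \<nu> j" by blast
      then have "g n = smul (of_real (norm (g n))) (e j)"
        using g_nonzero[of j] by (simp add: e_def)
      then show ?thesis using j by (metis imageI span_base span_scale)
    next
      case False
      then show ?thesis by (simp add: g_def gram_schmidt_zero v_def span_zero)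
    qed
    then have "range g \<subseteq> span (e ` J)" by blast
    then have "span (range g) \<subseteq> span (e ` J)" by (simp add: span_minimal)
    then have "v n \<in> span (e ` J)" for n
      using in_span_gram_schmidt[of v n] by (auto simp: g_def)
    then show "f ` J \<subseteq> span (e ` J)" by (metis image_subsetI v)
  qed
  ultimately show ?thesis
    unfolding orthonormal_basis_of_def by (intro exI[of _ e]) (auto dest: closed_span_eqI)
qed

section \<open>Riesz sequences\<close>

text \<open>Finite orthonormal combinations satisfy Pythagoras, that is, both Riesz bounds with constant \<open>1\<close>.
  The difference of \<open>x\<close> and its expansion lies in \<open>V\<close> and is orthogonal to the basis, so it is \<open>0\<close>.\<close>

lemma
  assumes e: "orthonormal_basis_of smul ip V e J"
  shows orthonormal_basis_bessel: "bessel_bound 1 e J"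
    and orthonormal_basis_parseval:
      "x \<in> V \<Longrightarrow> (\<Sum>\<^sub>\<infinity>j\<in>J. (norm (ip x (e j)))\<^sup>2) = (norm x)\<^sup>2"
proof -
  have ip_e: "ip (e i) (e j) = (if i = j then 1 else 0)" if "i \<in> J" "j \<in> J" for i j
    using e that by (simp add: orthonormal_basis_of_def)
  have V: "V = closed_span smul (e ` J)"
    using e by (simp add: orthonormal_basis_of_def)
  have pythagoras: "(norm (\<Sum>i\<in>K. smul (c i) (e i)))\<^sup>2 = (\<Sum>i\<in>K. (norm (c i))\<^sup>2)"
    if "finite K" "K \<subseteq> J" for K c
  proof -
    let ?x = "\<Sum>i\<in>K. smul (c i) (e i)"
    have "ip ?x ?x = (\<Sum>i\<in>K. \<Sum>j\<in>K. conjg (c i) * (c j * ip (e j) (e i)))"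
      by (simp only: ip_combination_left ip_combination_right sum_distrib_left)
    also have "\<dots> = (\<Sum>i\<in>K. \<Sum>j\<in>K. if i = j then c i * conjg (c i) else 0)"
      using that by (intro sum.cong refl) (auto simp: ip_e subset_iff mult.commute)
    also have "\<dots> = of_real (\<Sum>i\<in>K. (norm (c i))\<^sup>2)"
      using that by (simp add: mult_conjg_of_real)
    finally show ?thesis by (simp only: ip_self of_real_eq_iff)
  qed
  then show bessel: "bessel_bound 1 e J"
    by (simp add: bessel_bound_def)
  have lower: "lower_riesz_bound 1 e J"
    using pythagoras by (simp add: lower_riesz_bound_def)
  show "(\<Sum>\<^sub>\<infinity>j\<in>J. (norm (ip x (e j)))\<^sup>2) = (norm x)\<^sup>2" if "x \<in> V"
  proof -
    define y where "y = cross_operator e e J x"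
    have norm_y: "(norm y)\<^sup>2 = (\<Sum>\<^sub>\<infinity>j\<in>J. (norm (ip x (e j)))\<^sup>2)"
      unfolding y_def
      using norm_cross_operator_le_analysis[OF bessel _ bessel, of x]
        norm_cross_operator_ge_analysis[OF bessel _ bessel _ lower, of x]
      by simp
    have "y \<in> V" unfolding y_def V
      by (rule cross_operator_in_closed_span[OF bessel _ bessel]) simp_all
    have "ip y (e j) = ip x (e j)" if "j \<in> J" for j
    proof (rule has_sum_unique)
      show "((\<lambda>i. ip (smul (ip x (e i)) (e i)) (e j)) has_sum ip y (e j)) J"
        unfolding y_def by (rule has_sum_bounded_linear[OF bounded_linear_ip_left
              cross_operator_has_sum[OF bessel _ bessel]]) simp_all
      have "((\<lambda>i. ip (smul (ip x (e i)) (e i)) (e j)) has_sum ip x (e j)) {j}"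
        using that by (intro has_sum_finiteI) (simp_all add: ip_scale_left ip_e)
      then show "((\<lambda>i. ip (smul (ip x (e i)) (e i)) (e j)) has_sum ip x (e j)) J"
        using that by (subst has_sum_cong_neutral[where T="{j}"]) (auto simp: ip_scale_left ip_e)
    qed
    then have "ip (x - y) (e j) = 0" if "j \<in> J" for j
      using that by (simp add: ip_diff_left)
    then have "ip z (x - y) = 0" if "z \<in> e ` J" for z
      using that by (subst ip_commute) auto
    moreover have "x - y \<in> closed_span smul (e ` J)"
      using \<open>x \<in> V\<close> \<open>y \<in> V\<close> unfolding V by (rule subspace_diff[OF subspace_closed_span])
    ultimately have "ip (x - y) (x - y) = 0"
      by (rule orthogonal_closed_span)
    then have "x = y" by (simp add: ip_self)
    then show ?thesis using norm_y by simp
  qed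
qed

text \<open>For Riesz bounds \<open>A\<close> and \<open>B\<close> the operator sending an orthonormal basis \<open>e\<close> of the closed span
  to \<open>f\<close> is bounded above and below, hence injective with closed range; the range contains every
  \<open>f j\<close>, hence it is the whole closed span.\<close>

theorem riesz_sequence_if_riesz_bounds:
  assumes "countable J" and "0 < A" and lower: "lower_riesz_bound A f J"
    and "0 < B" and upper: "bessel_bound B f J"
  shows "riesz_sequence smul ip f J"
proof -
  define V where "V = closed_span smul (f ` J)"
  obtain e where e: "orthonormal_basis_of smul ip V e J"
    unfolding V_def using orthonormal_basis_of_closed_span_exists[OF lower] assms by blast
  note e_bessel = orthonormal_basis_bessel[OF e]
  define T where "T = cross_operator e f J"
  have T_linear: "bounded_linear T"
    unfolding T_def using bounded_linear_cross_operator[OF e_bessel _ upper \<open>0 < B\<close>] by simp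
  have T_add: "T (x + y) = T x + T y" for x y
    by (rule linear_add[OF bounded_linear.linear[OF T_linear]])
  have T_diff: "T (x - y) = T x - T y" for x y
    by (rule linear_diff[OF bounded_linear.linear[OF T_linear]])
  have T_smul: "T (smul c x) = smul c (T x)" for c x
    unfolding T_def using cross_operator_smul[OF e_bessel _ upper \<open>0 < B\<close>] by simp
  have T_e: "T (e j) = f j" if "j \<in> J" for j
  proof (rule has_sum_unique)
    show "((\<lambda>i. smul (ip (e j) (e i)) (f i)) has_sum T (e j)) J"
      unfolding T_def using cross_operator_has_sum[OF e_bessel _ upper \<open>0 < B\<close>] by simp
    have ip_e: "ip (e j) (e i) = (if i = j then 1 else 0)" if "i \<in> J" for i
      using e that \<open>j \<in> J\<close> by (auto simp: orthonormal_basis_of_def)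
    have "((\<lambda>i. smul (ip (e j) (e i)) (f i)) has_sum f j) {j}"
      using that by (intro has_sum_finiteI) (simp_all add: ip_e)
    then show "((\<lambda>i. smul (ip (e j) (e i)) (f i)) has_sum f j) J"
      using that by (subst has_sum_cong_neutral[where T="{j}"]) (auto simp: ip_e)
  qed
  have T_lower: "norm (T x) \<ge> sqrt A * norm x" if "x \<in> V" for x
  proof (rule power2_le_imp_le)
    show "(sqrt A * norm x)\<^sup>2 \<le> (norm (T x))\<^sup>2"
      using norm_cross_operator_ge_analysis[OF e_bessel _ upper \<open>0 < B\<close> lower, of x]
        orthonormal_basis_parseval[OF e that] \<open>0 < A\<close>
      by (simp add: T_def power_mult_distrib)
  qed simp
  have V_sub: "subspace V" unfolding V_def by (rule subspace_closed_span)
  have "inj_on T V"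
  proof (rule inj_onI)
    fix x y assume "x \<in> V" "y \<in> V" "T x = T y"
    then have "sqrt A * norm (x - y) \<le> 0"
      using T_lower[of "x - y"] subspace_diff[OF V_sub] by (simp add: T_diff)
    then show "x = y" using \<open>0 < A\<close> by (simp add: mult_le_0_iff)
  qed
  moreover have "T ` V = V"
  proof
    show "T ` V \<subseteq> V"
      unfolding T_def V_def
      using cross_operator_in_closed_span[OF e_bessel _ upper \<open>0 < B\<close>] by auto
    have "complete (T ` V)"
    proof (rule complete_isometric_image[OF _ _ T_linear])
      show "0 < sqrt A" using \<open>0 < A\<close> by simp
      show "Real_Vector_Spaces.subspace V"
        using V_sub unfolding real_vector.subspace_def subspace_def
        by (metis scale_of_real)
      show "complete V"
        unfolding V_def using closed_closed_span complete_eq_closed by blast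
    qed (use T_lower in blast)
    moreover have "subspace (T ` V)"
    proof (rule subspaceI)
      show "0 \<in> T ` V"
        using subspace_0[OF V_sub] T_diff[of 0 0] by (metis diff_self image_eqI)
      show "x + y \<in> T ` V" if "x \<in> T ` V" "y \<in> T ` V" for x y
        using that subspace_add[OF V_sub] by (auto simp flip: T_add)
      show "smul c x \<in> T ` V" if "x \<in> T ` V" for c x
        using that subspace_scale[OF V_sub] by (auto simp flip: T_smul)
    qed
    moreover have "f ` J \<subseteq> T ` V"
    proof
      fix y assume "y \<in> f ` J"
      then obtain j where "j \<in> J" "y = f j" by blast
      moreover from this have "e j \<in> V"
        using e closed_span_superset[of "e ` J"] by (auto simp: orthonormal_basis_of_def)
      ultimately show "y \<in> T ` V" using T_e by (metis image_eqI)
    qed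
    ultimately show "V \<subseteq> T ` V"
      unfolding V_def by (intro closed_span_least complete_imp_closed)
  qed
  ultimately have "bij_betw T V V" by (simp add: bij_betw_def)
  moreover have "\<exists>C. \<forall>x\<in>V. norm (T x) \<le> C * norm x"
    using bounded_linear.bounded[OF T_linear] by (auto simp: mult.commute)
  ultimately have "bounded_bijective_on smul V T"
    unfolding bounded_bijective_on_def using T_add T_smul by blast
  then show ?thesis
    unfolding riesz_sequence_def riesz_basis_of_def V_def[symmetric]
    using e T_e by (intro exI[of _ e] exI[of _ T]) simp
qed

end

section \<open>Colouring the index set\<close>

text \<open>Greedy colouring along an enumeration: an index avoids the colours of its at most \<open>D\<close>
  earlier neighbours.\<close>

lemma bounded_degree_colouring:
  assumes "countable I" and sym: "\<And>i j. R i j \<Longrightarrow> R j i"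
    and deg: "\<And>i. i \<in> I \<Longrightarrow> finite {j \<in> I. R i j} \<and> card {j \<in> I. R i j} \<le> D"
  shows "\<exists>col. col ` I \<subseteq> {..D::nat} \<and> (\<forall>i\<in>I. \<forall>j\<in>I. i \<noteq> j \<longrightarrow> R i j \<longrightarrow> col i \<noteq> col j)"
proof -
  define \<nu> where "\<nu> = to_nat_on I"
  define P where "P col i r \<longleftrightarrow> (i \<in> I \<longrightarrow> r \<le> D \<and> (\<forall>j\<in>I. R i j \<and> \<nu> j < \<nu> i \<longrightarrow> col j \<noteq> r))"
    for col i and r :: nat
  have "\<exists>col. \<forall>i. P col i (col i)"
  proof (rule dependent_wf_choice[where R = "inv_image less_than \<nu>"])
    show "P col i r = P col' i r"
      if "\<And>z. (z, i) \<in> inv_image less_than \<nu> \<Longrightarrow> col z = col' z" for col col' i r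
      using that by (auto simp: P_def)
    show "\<exists>r. P col i r" for i col
    proof (cases "i \<in> I")
      case True
      then have "card (col ` {j \<in> I. R i j}) < card {..D}"
        using deg[OF True] card_image_le[of "{j \<in> I. R i j}" col] by simp
      then have "\<not> {..D} \<subseteq> col ` {j \<in> I. R i j}"
        using deg[OF True] card_mono by (metis finite_imageI not_less)
      then show ?thesis by (auto simp: P_def)
    qed (simp add: P_def)
  qed simp
  then obtain col where col: "\<And>i. P col i (col i)" by blast
  have "col i \<noteq> col j" if "i \<in> I" "j \<in> I" "i \<noteq> j" "R i j" for i j
  proof -
    have "\<nu> i \<noteq> \<nu> j"
      using that \<open>countable I\<close> by (simp add: \<nu>_def)
    then consider "\<nu> i < \<nu> j" | "\<nu> j < \<nu> i" by linarith
    then show ?thesis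
    proof cases
      case 1
      then show ?thesis using col[of j] that sym[of i j] by (auto simp: P_def)
    next
      case 2
      then show ?thesis using col[of i] that by (auto simp: P_def)
    qed
  qed
  moreover have "col ` I \<subseteq> {..D}" using col by (auto simp: P_def)
  ultimately show ?thesis by blast
qed

lemma abs_summable_small_outside_finite:
  fixes r :: "'g \<Rightarrow> real"
  assumes r: "(\<lambda>g. \<bar>r g\<bar>) summable_on C" and "\<epsilon> > 0"
  shows "\<exists>F. finite F \<and> F \<subseteq> C \<and> (\<forall>K. finite K \<and> K \<subseteq> C - F \<longrightarrow> (\<Sum>g\<in>K. \<bar>r g\<bar>) \<le> \<epsilon>)"
proof -
  obtain F where F: "finite F" "F \<subseteq> C"
    and near: "dist (\<Sum>g\<in>F. \<bar>r g\<bar>) (\<Sum>\<^sub>\<infinity>g\<in>C. \<bar>r g\<bar>) \<le> \<epsilon>"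
    using infsum_finite_approximation[OF r \<open>\<epsilon> > 0\<close>] by blast
  have "(\<Sum>g\<in>K. \<bar>r g\<bar>) \<le> \<epsilon>" if K: "finite K" "K \<subseteq> C - F" for K
  proof -
    have "(\<Sum>g\<in>K. \<bar>r g\<bar>) + (\<Sum>g\<in>F. \<bar>r g\<bar>) = (\<Sum>g\<in>K \<union> F. \<bar>r g\<bar>)"
      using K F by (subst sum.union_disjoint) auto
    also have "\<dots> \<le> (\<Sum>\<^sub>\<infinity>g\<in>C. \<bar>r g\<bar>)"
      using K F by (intro finite_sum_le_infsum r) auto
    finally show ?thesis using near by (simp add: dist_real_def)
  qed
  then show ?thesis using F by blast
qed

text \<open>The classes are the colours of a proper colouring of the graph that joins two indices when
  \<open>a i \<otimes> inv a j\<close> or \<open>a j \<otimes> inv a i\<close> lies in a finite set \<open>F\<close> off which \<open>r\<close> has small \<open>\<ell>\<^sup>1\<close> norm;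
  a vertex has at most \<open>2 m\<close> neighbours for each element of \<open>F\<close>, because the fibres of \<open>a\<close> are bounded.
  With \<open>\<one> \<in> F\<close> the map \<open>a\<close> is injective on each class, so that each off-diagonal row or column is
  part of the tail of \<open>r\<close>.\<close>

lemma partition_with_small_off_diagonal:
  fixes G (structure) and r :: "'g \<Rightarrow> real"
  assumes "group G" and "countable I" and a: "a \<in> I \<rightarrow> carrier G"
    and fibres: "\<forall>g\<in>carrier G. finite {i \<in> I. a i = g} \<and> card {i \<in> I. a i = g} \<le> m"
    and r: "(\<lambda>g. \<bar>r g\<bar>) summable_on carrier G" and "\<epsilon> > 0"
  shows "\<exists>P. finite P \<and> partition_on I P \<and> (\<forall>J\<in>P. \<forall>i\<in>J. \<forall>K. finite K \<longrightarrow> K \<subseteq> J - {i} \<longrightarrow>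
      (\<Sum>j\<in>K. \<bar>r (a i \<otimes> inv a j)\<bar>) \<le> \<epsilon> \<and> (\<Sum>j\<in>K. \<bar>r (a j \<otimes> inv a i)\<bar>) \<le> \<epsilon>)"
proof -
  interpret group G by fact
  have aI: "a i \<in> carrier G" if "i \<in> I" for i using a that by blast
  obtain F0 where F0: "finite F0" "F0 \<subseteq> carrier G"
    and tail0: "\<And>K. finite K \<Longrightarrow> K \<subseteq> carrier G - F0 \<Longrightarrow> (\<Sum>g\<in>K. \<bar>r g\<bar>) \<le> \<epsilon>"
    using abs_summable_small_outside_finite[OF r \<open>\<epsilon> > 0\<close>] by metis
  define F where "F = insert \<one> F0"
  have F: "finite F" "F \<subseteq> carrier G" "\<one> \<in> F" using F0 by (auto simp: F_def)
  have tail: "(\<Sum>g\<in>K. \<bar>r g\<bar>) \<le> \<epsilon>" if "finite K" "K \<subseteq> carrier G - F" for K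
    using tail0[of K] that by (auto simp: F_def)
  define R where "R i j \<longleftrightarrow> a i \<otimes> inv a j \<in> F \<or> a j \<otimes> inv a i \<in> F" for i j
  have degree: "finite {j \<in> I. R i j} \<and> card {j \<in> I. R i j} \<le> card F * (m + m)" if "i \<in> I" for i
  proof -
    define N where "N h = {j \<in> I. a j = inv h \<otimes> a i} \<union> {j \<in> I. a j = h \<otimes> a i}" for h
    have "finite (N h) \<and> card (N h) \<le> m + m" if "h \<in> F" for h
    proof -
      have "inv h \<otimes> a i \<in> carrier G" "h \<otimes> a i \<in> carrier G"
        using that F aI[OF \<open>i \<in> I\<close>] by auto
      from this[THEN bspec[OF fibres]] show ?thesis
        unfolding N_def by (auto intro: order_trans[OF card_Un_le] add_mono)
    qed
    then have N: "finite (\<Union>h\<in>F. N h)" "card (\<Union>h\<in>F. N h) \<le> card F * (m + m)"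
      using F(1) card_UN_le[OF F(1), of N] sum_bounded_above[of F "\<lambda>h. card (N h)" "m + m"]
      by auto
    have "{j \<in> I. R i j} \<subseteq> (\<Union>h\<in>F. N h)"
    proof
      fix j assume "j \<in> {j \<in> I. R i j}"
      then have j: "j \<in> I" "R i j" by auto
      note c = aI[OF \<open>i \<in> I\<close>] aI[OF \<open>j \<in> I\<close>]
      have "a j = inv (a i \<otimes> inv a j) \<otimes> a i" "a j = (a j \<otimes> inv a i) \<otimes> a i"
        using c by (simp_all add: inv_mult_group m_assoc)
      then show "j \<in> (\<Union>h\<in>F. N h)"
        using j unfolding R_def N_def by blast
    qed
    then show ?thesis
      using N finite_subset card_mono order_trans by meson
  qed
  have "\<exists>col. col ` I \<subseteq> {..card F * (m + m)} \<and>
      (\<forall>i\<in>I. \<forall>j\<in>I. i \<noteq> j \<longrightarrow> R i j \<longrightarrow> col i \<noteq> col j)"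
    by (rule bounded_degree_colouring[OF \<open>countable I\<close> _ degree]) (auto simp: R_def)
  then obtain col :: "_ \<Rightarrow> nat" where col: "col ` I \<subseteq> {..card F * (m + m)}"
    and proper: "\<forall>i\<in>I. \<forall>j\<in>I. i \<noteq> j \<longrightarrow> R i j \<longrightarrow> col i \<noteq> col j"
    by (elim exE conjE)
  define P where "P = (\<lambda>n. {i \<in> I. col i = n}) ` (col ` I)"
  have "finite P" unfolding P_def using col finite_subset by blast
  moreover have "partition_on I P"
    by (rule partition_onI) (auto simp: P_def disjnt_def)
  moreover have "(\<Sum>j\<in>K. \<bar>r (a i \<otimes> inv a j)\<bar>) \<le> \<epsilon> \<and> (\<Sum>j\<in>K. \<bar>r (a j \<otimes> inv a i)\<bar>) \<le> \<epsilon>"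
    if "J \<in> P" "i \<in> J" "finite K" "K \<subseteq> J - {i}" for J i K
  proof -
    have no_conflict: "\<not> R j k" if "j \<in> J" "k \<in> J" "j \<noteq> k" for j k
    proof -
      have "j \<in> I" "k \<in> I" "col j = col k"
        using \<open>J \<in> P\<close> that by (auto simp: P_def)
      then show ?thesis using proper \<open>j \<noteq> k\<close> by metis
    qed
    have iI: "i \<in> I" and KI: "\<And>j. j \<in> K \<Longrightarrow> j \<in> I"
      using \<open>J \<in> P\<close> that by (auto simp: P_def)
    have apart: "a j \<otimes> inv a k \<notin> F" if "j \<in> insert i K" "k \<in> insert i K" "j \<noteq> k" for j k
      using no_conflict[of j k] that \<open>K \<subseteq> J - {i}\<close> \<open>i \<in> J\<close> by (auto simp: R_def)
    have inj: "a j \<noteq> a k" if "j \<in> K" "k \<in> K" "j \<noteq> k" for j k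
      using apart[of j k] F(3) that aI KI by auto
    have "inj_on (\<lambda>j. a i \<otimes> inv a j) K"
    proof (rule inj_onI)
      fix j k assume "j \<in> K" "k \<in> K" "a i \<otimes> inv a j = a i \<otimes> inv a k"
      then have "inv a j = inv a k"
        using aI KI iI \<open>j \<in> K\<close> \<open>k \<in> K\<close> by simp
      then show "j = k"
        using inj[of j k] \<open>j \<in> K\<close> \<open>k \<in> K\<close> aI KI by (metis inv_inv)
    qed
    then have "(\<Sum>j\<in>K. \<bar>r (a i \<otimes> inv a j)\<bar>) = (\<Sum>g\<in>(\<lambda>j. a i \<otimes> inv a j) ` K. \<bar>r g\<bar>)"
      by (simp add: sum.reindex)
    moreover have "(\<lambda>j. a i \<otimes> inv a j) ` K \<subseteq> carrier G - F"
      using apart[of i] that(4) aI KI iI by auto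
    moreover have "inj_on (\<lambda>j. a j \<otimes> inv a i) K"
    proof (rule inj_onI)
      fix j k assume "j \<in> K" "k \<in> K" "a j \<otimes> inv a i = a k \<otimes> inv a i"
      then have "a j = a k"
        using aI KI iI \<open>j \<in> K\<close> \<open>k \<in> K\<close> by simp
      then show "j = k" using inj[of j k] \<open>j \<in> K\<close> \<open>k \<in> K\<close> by blast
    qed
    then have "(\<Sum>j\<in>K. \<bar>r (a j \<otimes> inv a i)\<bar>) = (\<Sum>g\<in>(\<lambda>j. a j \<otimes> inv a i) ` K. \<bar>r g\<bar>)"
      by (simp add: sum.reindex)
    moreover have "(\<lambda>j. a j \<otimes> inv a i) ` K \<subseteq> carrier G - F"
      using apart[of _ i] that(4) aI KI iI by auto
    ultimately show ?thesis
      using tail \<open>finite K\<close> by (metis finite_imageI)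
  qed
  ultimately show ?thesis by blast
qed

section \<open>Boxes and density in the index group\<close>

lemma group_scaled_integer_group: "group (scaled_integer_group \<alpha>)"
proof (rule groupI)
  show "x \<otimes>\<^bsub>scaled_integer_group \<alpha>\<^esub> y \<in> carrier (scaled_integer_group \<alpha>)"
    if "x \<in> carrier (scaled_integer_group \<alpha>)" "y \<in> carrier (scaled_integer_group \<alpha>)" for x y
    using that by (auto simp: scaled_integer_group_def simp flip: distrib_left of_int_add)
  show "\<exists>y\<in>carrier (scaled_integer_group \<alpha>). y \<otimes>\<^bsub>scaled_integer_group \<alpha>\<^esub> x = \<one>\<^bsub>scaled_integer_group \<alpha>\<^esub>"
    if "x \<in> carrier (scaled_integer_group \<alpha>)" for x
  proof -
    from that obtain k where "x = \<alpha> * of_int k" by (auto simp: scaled_integer_group_def)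
    then show ?thesis
      by (intro bexI[of _ "\<alpha> * of_int (- k)"])
         (auto simp: scaled_integer_group_def simp del: of_int_minus)
  qed
  show "\<one>\<^bsub>scaled_integer_group \<alpha>\<^esub> \<in> carrier (scaled_integer_group \<alpha>)"
    by (auto simp: scaled_integer_group_def intro!: image_eqI[of _ _ 0])
qed (auto simp: scaled_integer_group_def)

lemma group_index_group: "group (index_group d e \<alpha> n)"
  unfolding index_group_def
  by (intro DirProd_group product_group group_scaled_integer_group group_integer_mod_group)

lemma finite_scaled_integers_le:
  fixes \<alpha> M :: real
  assumes "\<alpha> > 0"
  shows "finite {x \<in> range (\<lambda>k::int. \<alpha> * of_int k). \<bar>x\<bar> \<le> M}"
proof (rule finite_subset)
  show "{x \<in> range (\<lambda>k::int. \<alpha> * of_int k). \<bar>x\<bar> \<le> M} \<subseteq>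
      (\<lambda>k::int. \<alpha> * of_int k) ` {- \<lceil>M / \<alpha>\<rceil> .. \<lceil>M / \<alpha>\<rceil>}"
  proof
    fix x assume "x \<in> {x \<in> range (\<lambda>k::int. \<alpha> * of_int k). \<bar>x\<bar> \<le> M}"
    then obtain k :: int where x: "x = \<alpha> * of_int k" and "\<bar>x\<bar> \<le> M" by blast
    then have "\<bar>of_int k\<bar> \<le> M / \<alpha>"
      using assms by (simp add: abs_mult field_simps)
    then have "\<bar>k\<bar> \<le> \<lceil>M / \<alpha>\<rceil>" by linarith
    then show "x \<in> (\<lambda>k::int. \<alpha> * of_int k) ` {- \<lceil>M / \<alpha>\<rceil> .. \<lceil>M / \<alpha>\<rceil>}"
      unfolding x by (intro imageI) auto
  qed
qed simp

lemma abs_le_group_abs: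
  assumes "i < d"
  shows "\<bar>fst g i\<bar> \<le> group_abs d e g"
  unfolding group_abs_def using assms by (intro cSup_upper) auto

text \<open>The bound on the length confines each of the finitely many coordinates to a finite set.\<close>

lemma finite_group_abs_le:
  assumes "\<And>i. i < d \<Longrightarrow> \<alpha> i > 0" and "\<And>j. j < e \<Longrightarrow> n j \<ge> 1"
  shows "finite {k \<in> carrier (index_group d e \<alpha> n). group_abs d e k \<le> M}"
proof (rule finite_subset)
  let ?A = "\<Pi>\<^sub>E i\<in>{..<d}. {x \<in> range (\<lambda>k::int. \<alpha> i * of_int k). \<bar>x\<bar> \<le> M}"
  let ?B = "\<Pi>\<^sub>E j\<in>{..<e}. carrier (integer_mod_group (n j))"
  show "{k \<in> carrier (index_group d e \<alpha> n). group_abs d e k \<le> M} \<subseteq> ?A \<times> ?B"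
  proof clarify
    fix x y assume xy: "(x, y) \<in> carrier (index_group d e \<alpha> n)" "group_abs d e (x, y) \<le> M"
    have "\<bar>x i\<bar> \<le> M" if "i < d" for i
      using abs_le_group_abs[OF that, of "(x, y)" e] xy(2) by simp
    then show "x \<in> ?A \<and> y \<in> ?B"
      using xy(1) by (auto simp: index_group_def scaled_integer_group_def PiE_iff)
  qed
  have "finite (carrier (integer_mod_group (n j)))" if "j < e" for j
    using assms(2)[OF that] by (simp add: carrier_integer_mod_group)
  then show "finite (?A \<times> ?B)"
    using assms(1) by (intro finite_cartesian_product finite_PiE finite_scaled_integers_le) auto
qed

text \<open>As \<open>d \<ge> 1\<close>, the supremum is taken over \<open>{0}\<close> and not over the empty set, where \<open>Sup\<close> on
  \<open>real\<close> is an unspecified value.\<close>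

lemma group_abs_one:
  assumes "d \<ge> 1"
  shows "group_abs d e \<one>\<^bsub>index_group d e \<alpha> n\<^esub> = 0"
proof -
  have "(\<lambda>i. \<bar>fst \<one>\<^bsub>index_group d e \<alpha> n\<^esub> i\<bar>) ` {..<d} \<union>
      (\<lambda>j. if snd \<one>\<^bsub>index_group d e \<alpha> n\<^esub> j = 0 then 0 else 1) ` {..<e} = {0 :: real}"
    using assms by (auto simp: index_group_def scaled_integer_group_def intro!: image_eqI[of _ _ 0])
  then show ?thesis by (simp add: group_abs_def)
qed

text \<open>All boxes of a given size are translates of the one around the unit.\<close>

lemma
  fixes G :: "'g monoid" (structure)
  assumes "group G" and "j \<in> carrier G"
  shows card_group_box: "card (group_box G len N j) = card {k \<in> carrier G. len k \<le> real N / 2}"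
    and finite_group_box_iff: "finite (group_box G len N j) \<longleftrightarrow> finite {k \<in> carrier G. len k \<le> real N / 2}"
proof -
  interpret group G by fact
  have bij: "bij_betw (\<lambda>k. k \<otimes> j) {k \<in> carrier G. len k \<le> real N / 2} (group_box G len N j)"
    by (rule bij_betw_byWitness[where f' = "\<lambda>k. k \<otimes> inv j"])
       (use assms in \<open>auto simp: group_box_def m_assoc\<close>)
  then show "card (group_box G len N j) = card {k \<in> carrier G. len k \<le> real N / 2}"
    "finite (group_box G len N j) \<longleftrightarrow> finite {k \<in> carrier G. len k \<le> real N / 2}"
    using bij_betw_same_card[OF bij] bij_betw_finite[OF bij] by simp_all
qed

text \<open>An upper density below \<open>\<infinity>\<close> yields one \<open>N\<close> for which the boxes of size \<open>N\<close> contain a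
  bounded number of points relative to their common cardinality; the fibre over \<open>g\<close> lies in the box around \<open>g\<close>.\<close>

lemma bounded_fibres_if_finite_density:
  fixes G :: "'g monoid" (structure)
  assumes "group G" and balls: "\<And>M. finite {k \<in> carrier G. len k \<le> M}" and "len \<one> = 0"
    and density: "upper_density G len I a < \<infinity>"
  shows "\<exists>m. \<forall>g\<in>carrier G. finite {i \<in> I. a i = g} \<and> card {i \<in> I. a i = g} \<le> m"
proof -
  interpret group G by fact
  from Limsup_lessD[OF density[unfolded upper_density_def]]
  obtain N where N: "(SUP j\<in>carrier G.
       emeasure (count_space UNIV) {i \<in> I. a i \<in> group_box G len N j} /
       emeasure (count_space UNIV) (group_box G len N j)) < \<infinity>"
    by (meson eventually_happens sequentially_bot)
  define c where "c = card {k \<in> carrier G. len k \<le> real N / 2}"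
  define s where "s = (SUP j\<in>carrier G.
       emeasure (count_space UNIV) {i \<in> I. a i \<in> group_box G len N j} /
       emeasure (count_space UNIV) (group_box G len N j))"
  have "c > 0"
    unfolding c_def using balls[of "real N / 2"] \<open>len \<one> = 0\<close> by (auto simp: card_gt_0_iff)
  have "s * of_nat c < \<infinity>"
    using N by (simp add: s_def ennreal_mult_less_top of_nat_less_top)
  then obtain m :: nat where m: "s * of_nat c < of_nat m"
    using ennreal_Ex_less_of_nat by auto
  have "finite {i \<in> I. a i = g} \<and> card {i \<in> I. a i = g} \<le> m" if g: "g \<in> carrier G" for g
  proof -
    define X where "X = {i \<in> I. a i \<in> group_box G len N g}"
    have box: "emeasure (count_space UNIV) (group_box G len N g) = of_nat c"
      using card_group_box[OF \<open>group G\<close> g, of len N] finite_group_box_iff[OF \<open>group G\<close> g, of len N]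
        balls[of "real N / 2"]
      by (simp add: emeasure_count_space c_def)
    have "emeasure (count_space UNIV) X =
        emeasure (count_space UNIV) X / of_nat c * (of_nat c :: ennreal)"
      using \<open>c > 0\<close> by (simp add: ennreal_divide_times ennreal_divide_self of_nat_less_top)
    also have "\<dots> \<le> s * of_nat c"
      unfolding s_def X_def box[symmetric] using g by (intro mult_right_mono SUP_upper) auto
    also note m
    finally have X: "emeasure (count_space UNIV) X < of_nat m" .
    then have "finite X"
      by (cases "finite X") (auto simp: emeasure_count_space)
    then have "card X \<le> m" using X by (simp add: emeasure_count_space)
    have "{i \<in> I. a i = g} \<subseteq> X"
      using g \<open>len \<one> = 0\<close> by (auto simp: X_def group_box_def)
    then show ?thesis
      using \<open>finite X\<close> \<open>card X \<le> m\<close> finite_subset card_mono order_trans by meson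
  qed
  then show ?thesis by blast
qed

section \<open>Localized frame sequences are finite unions of Riesz sequences\<close>

theorem corollary3p12:
  fixes smul :: "'k::rc_field \<Rightarrow> 'v::banach \<Rightarrow> 'v"
    and ip :: "'v \<Rightarrow> 'v \<Rightarrow> 'k"
    and d e :: nat and \<alpha> :: "nat \<Rightarrow> real" and n :: "nat \<Rightarrow> nat"
    and G :: "index monoid"
    and f :: "'i \<Rightarrow> 'v" and I :: "'i set" and a :: "'i \<Rightarrow> index"
  assumes "hilbert_space smul ip"
    and "separable_space (euclidean :: 'v topology)"
    and "d \<ge> 1" and "\<And>i. i < d \<Longrightarrow> \<alpha> i > 0" and "\<And>j. j < e \<Longrightarrow> n j \<ge> 1"
    and "G = index_group d e \<alpha> n"
    and "countable I"
    and "frame_sequence smul ip f I"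
    and "a \<in> I \<rightarrow> carrier G"
    and "l1_localized_wrt_dual smul ip G f I a"
    and "upper_density G (group_abs d e) I a < \<infinity>"
    and "(INF i\<in>I. ennreal (norm (f i))) > 0"
  shows "\<exists>P. finite P \<and> partition_on I P \<and> (\<forall>J\<in>P. riesz_sequence smul ip f J)"
proof -
  interpret hilbert_space smul ip by fact
  let ?V = "closed_span smul (f ` I)"
  obtain A B where "0 < A" "0 < B" and frame: "\<forall>x\<in>?V.
      (\<lambda>i. (norm (ip x (f i)))\<^sup>2) summable_on I \<and>
      A * (norm x)\<^sup>2 \<le> (\<Sum>\<^sub>\<infinity>i\<in>I. (norm (ip x (f i)))\<^sup>2) \<and>
      (\<Sum>\<^sub>\<infinity>i\<in>I. (norm (ip x (f i)))\<^sup>2) \<le> B * (norm x)\<^sup>2"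
    using \<open>frame_sequence smul ip f I\<close> unfolding frame_sequence_def frame_for_def
    by (elim exE conjE)
  have bessel: "bessel_bound B f I"
    by (rule bessel_bound_if_analysis_le[OF subspace_closed_span closed_span_superset \<open>0 < B\<close>])
       (use frame in blast)
  have lower: "A * (norm x)\<^sup>2 \<le> (\<Sum>\<^sub>\<infinity>i\<in>I. (norm (ip x (f i)))\<^sup>2)" if "x \<in> ?V" for x
    using frame that by blast
  obtain C where "0 < C" and norms: "\<And>i. i \<in> I \<Longrightarrow> C \<le> norm (f i)"
  proof -
    obtain y where y: "0 < y" "y < (INF i\<in>I. ennreal (norm (f i)))"
      using dense[OF \<open>(INF i\<in>I. ennreal (norm (f i))) > 0\<close>] by blast
    then have "y < \<infinity>" using less_le_trans[OF y(2) top_greatest] by simp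
    then have y_eq: "ennreal (enn2real y) = y" by (simp add: less_top)
    have "0 < enn2real y" using y(1) \<open>y < \<infinity>\<close> by (simp add: enn2real_positive_iff)
    moreover have "enn2real y \<le> norm (f i)" if "i \<in> I" for i
    proof -
      have "ennreal (enn2real y) \<le> ennreal (norm (f i))"
        unfolding y_eq using order_trans[OF less_imp_le[OF y(2)] INF_lower[OF that]] .
      then show ?thesis by simp
    qed
    ultimately show ?thesis by (rule that)
  qed
  obtain r where r: "(\<lambda>g. \<bar>r g\<bar>) summable_on carrier G"
    and localized: "\<And>i j. i \<in> I \<Longrightarrow> j \<in> I \<Longrightarrow>
        norm (ip (f i) (canonical_dual smul ip f I j)) \<le> r (a i \<otimes>\<^bsub>G\<^esub> inv\<^bsub>G\<^esub> a j)"
    using \<open>l1_localized_wrt_dual smul ip G f I a\<close> unfolding l1_localized_wrt_dual_def by metis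
  have "group G" unfolding \<open>G = _\<close> by (rule group_index_group)
  have "\<exists>m. \<forall>g\<in>carrier G. finite {i \<in> I. a i = g} \<and> card {i \<in> I. a i = g} \<le> m"
  proof (rule bounded_fibres_if_finite_density[OF \<open>group G\<close>])
    show "finite {k \<in> carrier G. group_abs d e k \<le> M}" for M
      unfolding \<open>G = _\<close> by (rule finite_group_abs_le) fact+
    show "group_abs d e \<one>\<^bsub>G\<^esub> = 0"
      unfolding \<open>G = _\<close> by (rule group_abs_one) fact
  qed fact
  then obtain m where fibres:
      "\<forall>g\<in>carrier G. finite {i \<in> I. a i = g} \<and> card {i \<in> I. a i = g} \<le> m"
    by (elim exE)
  \<comment> \<open>The diagonal entries of the matrix \<open>ip (f i) (f~ j)\<close> are at least \<open>C\<^sup>2 / B\<close>; half of that is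
    left to the off-diagonal part.\<close>
  define \<epsilon> where "\<epsilon> = C\<^sup>2 / (2 * B)"
  have "\<epsilon> > 0" using \<open>0 < C\<close> \<open>0 < B\<close> by (simp add: \<epsilon>_def)
  obtain P where P: "finite P" "partition_on I P"
    and small: "\<forall>J\<in>P. \<forall>i\<in>J. \<forall>K. finite K \<longrightarrow> K \<subseteq> J - {i} \<longrightarrow>
      (\<Sum>j\<in>K. \<bar>r (a i \<otimes>\<^bsub>G\<^esub> inv\<^bsub>G\<^esub> a j)\<bar>) \<le> \<epsilon> \<and> (\<Sum>j\<in>K. \<bar>r (a j \<otimes>\<^bsub>G\<^esub> inv\<^bsub>G\<^esub> a i)\<bar>) \<le> \<epsilon>"
    using partition_with_small_off_diagonal[OF \<open>group G\<close> \<open>countable I\<close> \<open>a \<in> I \<rightarrow> carrier G\<close>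
        fibres r \<open>\<epsilon> > 0\<close>]
    by (elim exE conjE)
  have "riesz_sequence smul ip f J" if "J \<in> P" for J
  proof -
    have "J \<subseteq> I" using P(2) that by (auto dest: partition_onD1)
    have entry: "norm (ip (f i) (canonical_dual smul ip f I j)) \<le> \<bar>r (a i \<otimes>\<^bsub>G\<^esub> inv\<^bsub>G\<^esub> a j)\<bar>"
      if "i \<in> J" "j \<in> J" for i j
      using localized[of i j] that \<open>J \<subseteq> I\<close> by force
    have "lower_riesz_bound (A * (C\<^sup>2 / B - \<epsilon>)) f J"
    proof (rule lower_riesz_bound_if_diagonally_dominant[OF bessel \<open>0 < B\<close> \<open>0 < A\<close> lower])
      show "(\<Sum>j\<in>K. norm (ip (f i) (canonical_dual smul ip f I j))) \<le> \<epsilon>"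
        if i: "i \<in> J" and K: "finite K" "K \<subseteq> J - {i}" for i K
      proof -
        have "(\<Sum>j\<in>K. norm (ip (f i) (canonical_dual smul ip f I j))) \<le>
            (\<Sum>j\<in>K. \<bar>r (a i \<otimes>\<^bsub>G\<^esub> inv\<^bsub>G\<^esub> a j)\<bar>)"
          using i K by (intro sum_mono entry) auto
        also have "\<dots> \<le> \<epsilon>" using small \<open>J \<in> P\<close> i K by simp
        finally show ?thesis .
      qed
      show "(\<Sum>j\<in>K. norm (ip (f j) (canonical_dual smul ip f I i))) \<le> \<epsilon>"
        if i: "i \<in> J" and K: "finite K" "K \<subseteq> J - {i}" for i K
      proof -
        have "(\<Sum>j\<in>K. norm (ip (f j) (canonical_dual smul ip f I i))) \<le>
            (\<Sum>j\<in>K. \<bar>r (a j \<otimes>\<^bsub>G\<^esub> inv\<^bsub>G\<^esub> a i)\<bar>)"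
          using i K by (intro sum_mono entry) auto
        also have "\<dots> \<le> \<epsilon>" using small \<open>J \<in> P\<close> i K by simp
        finally show ?thesis .
      qed
    qed (use \<open>J \<subseteq> I\<close> norms \<open>0 < C\<close> in auto)
    moreover have "0 < A * (C\<^sup>2 / B - \<epsilon>)"
      using \<open>0 < A\<close> \<open>0 < B\<close> \<open>0 < C\<close> by (simp add: \<epsilon>_def field_simps)
    ultimately show ?thesis
      using riesz_sequence_if_riesz_bounds[of J "A * (C\<^sup>2 / B - \<epsilon>)" f B]
        countable_subset[OF \<open>J \<subseteq> I\<close> \<open>countable I\<close>] \<open>0 < B\<close> bessel_bound_subset[OF bessel \<open>J \<subseteq> I\<close>]
      by blast
  qed
  then show ?thesis using P by blast
qed

end
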